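(* Let $\{u_n\}_{n\ge 0}$ be one of the $15$ Apéry-like sequences. For all integers $\alpha$, $N_{\alpha}$ divides $N_{u_1}$, and $$N_{u_1}=M_{u_1}=\begin{cases}(v_2(u_1),v_3(u_1)) & \text{if } \{u_n\}_{n\ge 0}\text{ is of the second kind},\\ (v_2(u_1),v_3(u_1),v_4(u_1)) & \text{if } \{u_n\}_{n\ge 0}\text{ is of the first kind}.\end{cases}$$
   Context: Apéry-like sequences of the second kind (6 sequences): the integer sequences $\{u_n\}_{n\ge0}$ determined by $u_{-1}=0$, $u_0=1$ and $$(n+1)^2u_{n+1}-(An^2+An+\lambda)u_n+Bn^2u_{n-1}=0\quad(n\ge 0),$$ with $(A,B,\lambda)$ equal to $(7,-8,2)$ [name A], $(9,27,3)$ [B], $(10,9,3)$ [C], $(11,-1,3)$ [D], $(12,32,4)$ [E], $(17,72,6)$ [F]. Apéry-like sequences of the first kind (9 sequences): the integer sequences $\{u_n\}_{n\ge0}$ determined by $u_{-1}=0$, $u_0=1$ and $$(n+1)^3u_{n+1}-(2n+1)(an^2+an+b)u_n+n(cn^2+d)u_{n-1}=0\quad(n\ge0),$$ with $(a,b,c,d)$ equal to $(7,3,81,0)$ [name $\delta$], $(11,5,125,0)$ [$\eta$], $(10,4,64,0)$ [$\alpha$], $(12,4,16,0)$ [$\epsilon$], $(9,3,-27,0)$ [$\zeta$], $(17,5,1,0)$ [$\gamma$], $(13,4,-27,3)$ [$s_7$], $(6,2,-64,4)$ [$s_{10}$], $(14,6,192,-12)$ [$s_{18}$]. It is known that all these sequences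 consist of integers. Together they are the $15$ Apéry-like sequences. Binomial transform: for a complex number $x$, $v_n(x)=\sum_{k=0}^n\binom{n}{k}(-x)^{n-k}u_k$ for $n\ge0$. $(n_1,\dots,n_r)$ denotes the greatest positive common divisor of the integers $n_1,\dots,n_r$. For an integer $\alpha$, $M_\alpha=(v_1(\alpha),v_2(\alpha),v_3(\alpha))$ if $\{u_n\}$ is of the second kind, and $M_\alpha=(v_1(\alpha),v_2(\alpha),v_3(\alpha),v_4(\alpha))$ if $\{u_n\}$ is of the first kind. For an integer $\alpha$, $N_\alpha$ denotes the largest positive integer such that $u_n\equiv\alpha^n\pmod{N_\alpha}$ for all non-negative integers $n$. *)

theory Defs
  imports Complex_Main "HOL-Number_Theory.Cong"
begin

datatype apery_kind = First_Kind | Second_Kind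

definition second_kind_params :: "(int \<times> int \<times> int) set" where
  "second_kind_params =
    {(7, -8, 2), (9, 27, 3), (10, 9, 3), (11, -1, 3), (12, 32, 4), (17, 72, 6)}"

definition first_kind_params :: "(int \<times> int \<times> int \<times> int) set" where
  "first_kind_params =
    {(7, 3, 81, 0), (11, 5, 125, 0), (10, 4, 64, 0), (12, 4, 16, 0), (9, 3, -27, 0),
     (17, 5, 1, 0), (13, 4, -27, 3), (6, 2, -64, 4), (14, 6, 192, -12)}"

text \<open>The term \<open>if n = 0 then 0 else u (n - 1)\<close> encodes the convention that the
  sequence takes the value 0 at index -1.\<close>

definition second_kind_rec :: "int \<Rightarrow> int \<Rightarrow> int \<Rightarrow> (nat \<Rightarrow> int) \<Rightarrow> bool" where
  "second_kind_rec A B l u \<longleftrightarrow>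
    u 0 = 1 \<and>
    (\<forall>n. (int n + 1)^2 * u (n + 1) - (A * int n ^ 2 + A * int n + l) * u n
          + B * int n ^ 2 * (if n = 0 then 0 else u (n - 1)) = 0)"

definition first_kind_rec :: "int \<Rightarrow> int \<Rightarrow> int \<Rightarrow> int \<Rightarrow> (nat \<Rightarrow> int) \<Rightarrow> bool" where
  "first_kind_rec a b c d u \<longleftrightarrow>
    u 0 = 1 \<and>
    (\<forall>n. (int n + 1)^3 * u (n + 1) - (2 * int n + 1) * (a * int n ^ 2 + a * int n + b) * u n
          + int n * (c * int n ^ 2 + d) * (if n = 0 then 0 else u (n - 1)) = 0)"

fun apery_like :: "apery_kind \<Rightarrow> (nat \<Rightarrow> int) \<Rightarrow> bool" where
  "apery_like Second_Kind u \<longleftrightarrow>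
    (\<exists>(A, B, l) \<in> second_kind_params. second_kind_rec A B l u)"
| "apery_like First_Kind u \<longleftrightarrow>
    (\<exists>(a, b, c, d) \<in> first_kind_params. first_kind_rec a b c d u)"

definition binomial_transform :: "(nat \<Rightarrow> int) \<Rightarrow> 'a::comm_ring_1 \<Rightarrow> nat \<Rightarrow> 'a" where
  "binomial_transform u x n =
    (\<Sum>k=0..n. of_nat (n choose k) * (- x) ^ (n - k) * of_int (u k))"

fun M_gcd :: "apery_kind \<Rightarrow> (nat \<Rightarrow> int) \<Rightarrow> int \<Rightarrow> int" where
  "M_gcd Second_Kind u \<alpha> = Gcd (binomial_transform u \<alpha> ` {1, 2, 3})"
| "M_gcd First_Kind u \<alpha> = Gcd (binomial_transform u \<alpha> ` {1, 2, 3, 4})"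

text \<open>The maximum exists whenever \<open>u n \<noteq> \<alpha> ^ n\<close> for some \<open>n\<close>; this is the
  case for every Apery-like sequence and every \<open>\<alpha>\<close>.\<close>

definition N_max :: "(nat \<Rightarrow> int) \<Rightarrow> int \<Rightarrow> int" where
  "N_max u \<alpha> = (GREATEST N. N > 0 \<and> (\<forall>n. [u n = \<alpha> ^ n] (mod N)))"

end

theory Submission
  imports Defs "HOL-Computational_Algebra.Formal_Power_Series"
begin

text \<open>Suppose that \<open>u n\<close> is congruent to \<open>\<alpha>^n\<close> modulo \<open>N\<close> for all \<open>n\<close>. The case \<open>n = 1\<close> shows that \<open>\<alpha>\<close> is congruent to \<open>u 1\<close>, so
\<open>N\<close> is also a modulus for \<open>u 1\<close>; and then \<open>N\<close> divides every binomial transform \<open>v_n(u 1)\<close> with \<open>n > 0\<close>, which is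
congruent to \<open>(u 1 - u 1)^n\<close>. Since \<open>v_1(u 1) = 0\<close>, everything reduces (lemma \<open>N_max_eqI\<close>) to the claim that the greatest common divisor \<open>G\<close> of
the next two or three transforms is itself a modulus. This is one explicit congruence \<open>u n = (u 1)^n\<close> modulo \<open>G\<close> for each of
the 15 sequences: \<open>G\<close> is 6, 6, 6, 10, 4, 6 for A to F, and 24, 10, 12, 24, 6, 24, 8, 2, 6 for
\<open>\<delta>, \<eta>, \<alpha>, \<epsilon>, \<zeta>, \<gamma>, s_7, s_10, s_18\<close>.

The recurrence alone, read modulo a prime \<open>p\<close>, says nothing about \<open>u (n + 1)\<close> when \<open>p\<close> divides \<open>n + 1\<close>. So the
congruences are derived from closed forms, which are in turn justified by the recurrence, over the integers. There are three sources.

Hypergeometric pullbacks. For A, B, C, E, F the generating function is \<open>1 / (1 - l X)\<close> times \<open>H(r(X))\<close>, where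
\<open>l = u 1\<close> and \<open>H\<close> is the series with coefficients \<open>(3 k)! / k!^3\<close> or \<open>(2 k choose k)^2\<close>. These coefficients are divisible by 6
and 4 for \<open>k > 0\<close>, so modulo 6 and 4 only \<open>1 / (1 - l X)\<close> remains. For \<open>\<epsilon>\<close> and \<open>s_18\<close> the same works with \<open>(4 k)! / k!^4\<close>, which is
divisible by 24; in the case of \<open>s_18\<close> the prefactor is \<open>(1 - 12 X)^(-1/2)\<close>, which is congruent to 1 modulo 6.

Symmetric squares. The square of the generating function of a sequence of the second kind is, up to a rational
substitution, the generating function of one of the first kind (lemma \<open>symmetric_square\<close>). In this way A, B, C, D, F lead to
\<open>\<delta>, \<zeta>, \<alpha>, \<eta>, \<gamma>\<close>. The moduli 24 and 12, larger than those of A, C, F, come from the fact that the square of the series of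
\<open>(3 k)! / k!^3\<close> is \<open>1 + 12 X\<close> modulo 24 (lemma \<open>trinom_square\<close>).

Binomial sums. D, \<open>s_10\<close> and \<open>s_7\<close> are sums of products of binomial coefficients, by creative telescoping, and their
congruences follow from the theorem of Lucas on binomial coefficients modulo a prime.\<close>

unbundle fps_syntax

section \<open>Integer power series and the Euler operator\<close>

text \<open>The operator \<open>X d/dX\<close> multiplies the coefficient of \<open>X^n\<close> by \<open>n\<close>; a recurrence with coefficients polynomial
in the index is therefore the same thing as a linear equation in this operator and \<open>X\<close>.
All series have integer coefficients, so that congruences survive every operation.\<close>

definition euler :: "int fps \<Rightarrow> int fps" where "euler f = fps_X * fps_deriv f"

lemma euler_nth: "euler f $ n = int n * f $ n"
  by (cases n) (auto simp: euler_def)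

lemma euler_add: "euler (f + g) = euler f + euler g"
  and euler_diff: "euler (f - g) = euler f - euler g"
  and euler_minus: "euler (- f) = - euler f"
  and euler_mult: "euler (f * g) = euler f * g + f * euler g"
  by (simp_all add: euler_def algebra_simps)

lemma euler_power: "euler (f ^ k) = of_nat k * f ^ (k - 1) * euler f"
  by (simp add: euler_def fps_deriv_power' algebra_simps)

lemma euler_constants [simp]:
  "euler (of_int c) = 0" "euler (numeral k) = 0" "euler 1 = 0" "euler 0 = 0"
  by (simp_all add: euler_def flip: fps_of_int)

lemma euler_X [simp]: "euler fps_X = fps_X"
  by (simp add: euler_def)

lemmas euler_rules = euler_add euler_diff euler_minus euler_mult euler_power

text \<open>Stating the chain rule with the logarithmic derivative \<open>\<rho>\<close> of \<open>r\<close> avoids a division by \<open>r\<close>,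
which is not a unit.\<close>

lemma euler_compose:
  assumes "r $ 0 = 0" "euler r = \<rho> * r"
  shows "euler (H oo r) = \<rho> * (euler H oo r)"
proof -
  have "euler (H oo r) = (fps_deriv H oo r) * euler r"
    using assms by (simp add: euler_def fps_compose_deriv)
  also have "\<dots> = \<rho> * ((fps_X * fps_deriv H) oo r)"
    using assms by (simp add: fps_compose_mult_distrib)
  finally show ?thesis by (simp add: euler_def)
qed

lemma fps_const_mult_nth [simp]:
  "(of_int c * f) $ n = c * (f :: int fps) $ n" "(numeral k * f) $ n = numeral k * f $ n"
  "(f * numeral k) $ n = numeral k * f $ n"
  "(- numeral k * f) $ n = - numeral k * f $ n"
  by (simp_all add: numeral_fps_const neg_numeral_fps_const flip: fps_of_int)

section \<open>The recurrences as differential equations\<close>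

lemma second_kind_rec_iff:
  "second_kind_rec A B l u \<longleftrightarrow> u 0 = 1 \<and> (let f = Abs_fps u in
     euler (euler f) = fps_X * (of_int A * euler (euler f) + of_int A * euler f + of_int l * f)
       - fps_X^2 * (of_int B * (euler (euler f) + 2 * euler f + f)))"
proof -
  define f where "f = Abs_fps u"
  let ?L = "euler (euler f)"
  let ?R = "fps_X * (of_int A * euler (euler f) + of_int A * euler f + of_int l * f)
       - fps_X^2 * (of_int B * (euler (euler f) + 2 * euler f + f))"
  have 0: "?L $ 0 = ?R $ 0" by (simp add: euler_nth power2_eq_square mult.assoc)
  have *: "?L $ Suc n = ?R $ Suc n \<longleftrightarrow> (int n + 1)^2 * u (n + 1)
      - (A * int n ^ 2 + A * int n + l) * u n
      + B * int n ^ 2 * (if n = 0 then 0 else u (n - 1)) = 0" for n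
    by (cases n; simp add: euler_nth power2_eq_square mult.assoc f_def)
       (auto simp: algebra_simps)
  show ?thesis unfolding second_kind_rec_def Let_def f_def [symmetric] fps_eq_iff
    using 0 * by (metis not0_implies_Suc)
qed

lemma first_kind_rec_iff:
  "first_kind_rec a b c d u \<longleftrightarrow> u 0 = 1 \<and> (let F = Abs_fps u; F1 = euler F; F2 = euler F1; F3 = euler F2 in
     F3 = fps_X * (of_int (2*a) * F3 + of_int (3*a) * F2 + of_int (a + 2*b) * F1 + of_int b * F)
       - fps_X^2 * (of_int c * (F3 + 3 * F2 + 3 * F1 + F) + of_int d * (F1 + F)))"
proof -
  define F where "F = Abs_fps u"
  let ?L = "euler (euler (euler F))"
  let ?R = "fps_X * (of_int (2*a) * euler (euler (euler F)) + of_int (3*a) * euler (euler F)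
          + of_int (a + 2*b) * euler F + of_int b * F)
       - fps_X^2 * (of_int c * (euler (euler (euler F)) + 3 * euler (euler F) + 3 * euler F + F)
          + of_int d * (euler F + F))"
  have 0: "?L $ 0 = ?R $ 0" by (simp add: euler_nth power2_eq_square mult.assoc)
  have *: "?L $ Suc n = ?R $ Suc n \<longleftrightarrow> (int n + 1)^3 * u (n + 1)
      - (2 * int n + 1) * (a * int n ^ 2 + a * int n + b) * u n
      + int n * (c * int n ^ 2 + d) * (if n = 0 then 0 else u (n - 1)) = 0" for n
    by (cases n; simp add: euler_nth power2_eq_square power3_eq_cube mult.assoc F_def 
          del: of_int_add of_int_mult)
       (auto simp: algebra_simps)
  show ?thesis unfolding first_kind_rec_def Let_def F_def [symmetric] fps_eq_iff
    using 0 * by (metis not0_implies_Suc)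
qed

text \<open>The recurrence fixes \<open>(n + 1)^2 * u (n + 1)\<close>, and a factor \<open>(n + 1)^2\<close> can be cancelled
in the integers, though not modulo a prime that divides it. A closed form is thus established
by checking the recurrence.\<close>

lemma second_kind_rec_unique:
  assumes "second_kind_rec A B l u" "second_kind_rec A B l v"
  shows "u = v"
proof
  fix n show "u n = v n"
  proof (induction n rule: less_induct)
    case (less n)
    show ?case
    proof (cases n)
      case 0 then show ?thesis using assms by (simp add: second_kind_rec_def)
    next
      case (Suc m)
      have "(int m + 1)^2 * u (m + 1) = (int m + 1)^2 * v (m + 1)"
        using assms less [of m] less [of "m - 1"] Suc
        unfolding second_kind_rec_def by (smt (verit) diff_Suc_less lessI less_imp_diff_less)
      then show ?thesis using Suc by simp
    qed
  qed
qed

lemma first_kind_rec_unique: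
  assumes "first_kind_rec a b c d u" "first_kind_rec a b c d v"
  shows "u = v"
proof
  fix n show "u n = v n"
  proof (induction n rule: less_induct)
    case (less n)
    show ?case
    proof (cases n)
      case 0 then show ?thesis using assms by (simp add: first_kind_rec_def)
    next
      case (Suc m)
      have "(int m + 1)^3 * u (m + 1) = (int m + 1)^3 * v (m + 1)"
        using assms less [of m] less [of "m - 1"] Suc
        unfolding first_kind_rec_def by (smt (verit) diff_Suc_less lessI less_imp_diff_less)
      then show ?thesis using Suc by simp
    qed
  qed
qed

section \<open>Geometric series and the variable of the binomial transform\<close>

text \<open>The congruence \<open>u n = a^n\<close> modulo \<open>N\<close> for all \<open>n\<close> says that the generating function of \<open>u\<close> is
congruent to \<open>geo a = 1 / (1 - a X)\<close>. In the variable \<open>t = X / (1 - a X)\<close> of the binomial transform,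
\<open>geo a\<close> becomes the polynomial \<open>1 + a t\<close>, and the Euler operator acts on polynomials in \<open>t\<close> as
\<open>t (1 + a t) d/dt\<close>. Hence identities between rational functions of \<open>X\<close> with denominators \<open>1 - a X\<close>
can be checked as polynomial identities in \<open>t\<close>.\<close>

definition geo :: "int \<Rightarrow> int fps" where "geo a = Abs_fps (\<lambda>n. a ^ n)"

lemma geo_nth [simp]: "geo a $ n = a ^ n" by (simp add: geo_def)

lemma geo_inverse: "(1 - of_int a * fps_X) * geo a = 1"
proof (rule fps_ext)
  fix n show "((1 - of_int a * fps_X) * geo a) $ n = 1 $ n"
    by (cases n) (simp_all add: left_diff_distrib mult.assoc)
qed

lemma euler_geo: "euler (geo a) = of_int a * fps_X * geo a ^ 2"
proof -
  have "0 = euler ((1 - of_int a * fps_X) * geo a)" by (simp add: geo_inverse)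
  also have "\<dots> = (1 - of_int a * fps_X) * euler (geo a) - of_int a * fps_X * geo a"
    by (simp add: euler_mult euler_diff)
  finally show ?thesis using geo_inverse[of a] by algebra
qed

definition geo_var :: "int \<Rightarrow> int fps" where "geo_var a = fps_X * geo a"

lemma geo_eq: "geo a = 1 + of_int a * geo_var a"
  using geo_inverse [of a] by (simp add: geo_var_def algebra_simps)

lemma euler_geo_var: "euler (geo_var a) = geo_var a * geo a"
proof -
  have "euler (geo_var a) = geo_var a + geo_var a * (of_int a * geo_var a)"
    by (simp add: geo_var_def euler_mult euler_geo power2_eq_square algebra_simps)
  also have "\<dots> = geo_var a * geo a" unfolding geo_eq by (simp add: algebra_simps)
  finally show ?thesis .
qed

lemma euler_geo_var_form: "euler (geo a) = of_int a * geo_var a * geo a"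
  by (simp add: euler_geo geo_var_def power2_eq_square algebra_simps)

lemma geo_nonzero: "geo a \<noteq> 0"
  using geo_inverse [of a] by auto

section \<open>Pullbacks of hypergeometric series of order two\<close>

lemma hypergeometric_ode2:
  fixes H :: "int fps"
  assumes "\<And>n. (int n + 1)^2 * H $ (n + 1) = (\<kappa> * int n^2 + \<kappa> * int n + \<mu>) * H $ n"
  shows "fps_X * (1 - of_int \<kappa> * fps_X) * fps_deriv (fps_deriv H)
           + (1 - 2 * of_int \<kappa> * fps_X) * fps_deriv H - of_int \<mu> * H = 0"
proof (rule fps_ext)
  fix n
  have "(fps_X * fps_deriv (fps_deriv H) - of_int \<kappa> * (fps_X * (fps_X * fps_deriv (fps_deriv H)))
           + fps_deriv H - 2 * (of_int \<kappa> * (fps_X * fps_deriv H)) - of_int \<mu> * H) $ n = 0"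
    using assms [of n]
    by (cases n; cases "n - 1"; simp) (auto simp: algebra_simps power2_eq_square)
  then show "(fps_X * (1 - of_int \<kappa> * fps_X) * fps_deriv (fps_deriv H)
           + (1 - 2 * of_int \<kappa> * fps_X) * fps_deriv H - of_int \<mu> * H) $ n = 0 $ n"
    by (simp add: algebra_simps)
qed

text \<open>The series \<open>geo l * (H oo r)\<close> and its first two images under the Euler operator are combinations of
\<open>H, H', H''\<close> evaluated at \<open>r\<close>. Its differential equation, multiplied by \<open>q^2\<close> so that only \<open>t\<close> and
\<open>q = 1 + l t\<close> occur, is a multiple \<open>M\<close> of the hypergeometric equation at \<open>r\<close>; the three hypotheses
compare the coefficients of \<open>H'', H', H\<close>. The factor \<open>M\<close> is found from the first of them.\<close>

lemma second_kind_pullback: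
  fixes H r :: "int fps" and l :: int
  defines "t \<equiv> geo_var l" and "q \<equiv> geo l"
  assumes r0: "r $ 0 = 0" and H0: "H $ 0 = 1"
    and H: "\<And>n. (int n + 1)^2 * H $ (n + 1) = (\<kappa> * int n^2 + \<kappa> * int n + \<mu>) * H $ n"
    and dr: "euler r = dr" and ddr: "euler dr = ddr"
    and c2: "q * dr^2 * (q^2 - of_int A * q * t + of_int B * t^2) = M * (r * (1 - of_int \<kappa> * r))"
    and c1: "(2 * of_int l * t * q * dr + q * ddr) * (q^2 - of_int A * q * t + of_int B * t^2)
               + q * dr * (2 * of_int B * t^2 - of_int A * q * t) = M * (1 - 2 * of_int \<kappa> * r)"
    and c0: "(of_int l * t * q^2 + of_int l^2 * t^2 * q) * (q^2 - of_int A * q * t + of_int B * t^2)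
               + of_int l * t * q * (2 * of_int B * t^2 - of_int A * q * t)
               + q * (of_int B * t^2 - of_int l * q * t) = - (M * of_int \<mu>)"
  shows "second_kind_rec A B l (fps_nth (geo l * (H oo r)))"
proof -
  define h0 h1 h2 where "h0 = H oo r" and "h1 = fps_deriv H oo r"
    and "h2 = fps_deriv (fps_deriv H) oo r"
  have X: "fps_X oo r = r" using r0 by simp
  have "0 = (fps_X * (1 - of_int \<kappa> * fps_X) * fps_deriv (fps_deriv H)
           + (1 - 2 * of_int \<kappa> * fps_X) * fps_deriv H - of_int \<mu> * H) oo r"
    by (simp add: hypergeometric_ode2 [OF H])
  also have "\<dots> = r * (1 - of_int \<kappa> * r) * h2 + (1 - 2 * of_int \<kappa> * r) * h1 - of_int \<mu> * h0"
    by (simp add: fps_compose_add_distrib fps_compose_sub_distrib fps_compose_mult_distrib r0 X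
          h0_def h1_def h2_def flip: fps_of_int)
  finally have ode: "r * (1 - of_int \<kappa> * r) * h2 + (1 - 2 * of_int \<kappa> * r) * h1 - of_int \<mu> * h0 = 0" ..
  have h: "euler h0 = h1 * dr" "euler h1 = h2 * dr"
    using dr r0 by (auto simp: h0_def h1_def h2_def euler_def fps_compose_deriv algebra_simps)
  have q: "euler q = of_int l * t * q" and t: "euler t = t * q"
    by (simp_all add: q_def t_def euler_geo_var_form euler_geo_var)
  define f f1 f2 where "f = q * h0" and "f1 = euler f" and "f2 = euler f1"
  have f1: "f1 = of_int l * t * q * h0 + q * h1 * dr"
    by (simp add: f1_def f_def euler_rules q h algebra_simps)
  have f2: "f2 = (of_int l * t * q^2 + of_int l^2 * t^2 * q) * h0 + 2 * of_int l * t * q * h1 * dr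
               + q * h2 * dr^2 + q * h1 * ddr"
    unfolding f2_def f1 by (simp add: euler_rules q t h ddr algebra_simps power2_eq_square)
  have "q^2 * f2 - q * t * (of_int A * f2 + of_int A * f1 + of_int l * f)
               + of_int B * t^2 * (f2 + 2 * f1 + f)
      = M * (r * (1 - of_int \<kappa> * r)) * h2 + M * (1 - 2 * of_int \<kappa> * r) * h1 + - (M * of_int \<mu>) * h0"
    unfolding c2 [symmetric] c1 [symmetric] c0 [symmetric] f2 f1 f_def by algebra
  also have "\<dots> = M * (r * (1 - of_int \<kappa> * r) * h2 + (1 - 2 * of_int \<kappa> * r) * h1 - of_int \<mu> * h0)"
    by algebra
  finally have "q^2 * f2 - q * t * (of_int A * f2 + of_int A * f1 + of_int l * f)
               + of_int B * t^2 * (f2 + 2 * f1 + f) = 0"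
    using ode by simp
  then have "q^2 * (f2 - fps_X * (of_int A * f2 + of_int A * f1 + of_int l * f)
               + fps_X^2 * (of_int B * (f2 + 2 * f1 + f))) = 0"
    by (simp add: t_def q_def geo_var_def algebra_simps power2_eq_square)
  then have "f2 - fps_X * (of_int A * f2 + of_int A * f1 + of_int l * f)
               + fps_X^2 * (of_int B * (f2 + 2 * f1 + f)) = 0"
    using geo_nonzero by (simp add: q_def)
  then have "f2 = fps_X * (of_int A * f2 + of_int A * f1 + of_int l * f)
               - fps_X^2 * (of_int B * (f2 + 2 * f1 + f))"
    by (metis (no_types) add_diff_eq diff_add_eq eq_iff_diff_eq_0 diff_diff_eq2)
  moreover have "f $ 0 = 1" by (simp add: f_def q_def h0_def H0)
  ultimately have "second_kind_rec A B l (fps_nth f)"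
    unfolding second_kind_rec_iff fps_nth_inverse Let_def f2_def f1_def by blast
  then show ?thesis unfolding f_def h0_def q_def .
qed

text \<open>This makes the divisibility of \<open>(m k)! / k!^m\<close> by \<open>m!\<close> for positive \<open>k\<close> visible: this quotient is the
product of the binomial coefficients \<open>i * k choose k\<close> with \<open>i\<close> from 2 to \<open>m\<close>.\<close>

lemma choose_multiple:
  assumes "k > 0" shows "(m * k) choose k = m * ((m * k - 1) choose (k - 1))"
proof -
  have "k * ((m * k) choose k) = k * (m * ((m * k - 1) choose (k - 1)))"
    using assms by (subst times_binomial_minus1_eq) auto
  then show ?thesis using assms by simp
qed

lemma factorial_binomial2: "fact k ^ 2 * (2 * k choose k) = fact (2 * k)"
  using binomial_fact_lemma[of k "2 * k"] by (simp add: power2_eq_square)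

lemma factorial_binomial3: "fact k ^ 3 * ((3 * k choose k) * (2 * k choose k)) = fact (3 * k)"
proof -
  have "fact (3 * k) = fact k * fact (2 * k) * (3 * k choose k)"
    using binomial_fact_lemma[of k "3 * k"] by simp
  then show ?thesis by (simp add: power3_eq_cube power2_eq_square flip: factorial_binomial2)
qed

lemma factorial_binomial4:
  "fact k ^ 4 * ((4 * k choose k) * (3 * k choose k) * (2 * k choose k)) = fact (4 * k)"
proof -
  have "fact (4 * k) = fact k * fact (3 * k) * (4 * k choose k)"
    using binomial_fact_lemma[of k "4 * k"] by simp
  then show ?thesis by (simp add: power4_eq_xxxx power3_eq_cube flip: factorial_binomial3)
qed

lemma fact_Suc_power: "fact (k + 1) ^ m = fact k ^ m * (k + 1) ^ m"
  by (metis Suc_eq_plus1 fact_Suc mult.commute of_nat_id power_mult_distrib)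

lemma fact_add_3: "fact (n + 3) = (n + 3) * (n + 2) * (n + 1) * fact n"
  by (simp only: eval_nat_numeral BitM.simps numeral_One One_nat_def add_Suc_right add_0_right fact_Suc of_nat_id mult.assoc)

lemma fact_add_4: "fact (n + 4) = (n + 4) * (n + 3) * (n + 2) * (n + 1) * fact n"
  by (simp only: eval_nat_numeral BitM.simps numeral_One One_nat_def add_Suc_right add_0_right fact_Suc of_nat_id mult.assoc)

lemma binomial2_rec: "(k + 1) * (2 * (k + 1) choose (k + 1)) = 2 * (2 * k + 1) * (2 * k choose k)"
proof -
  have "fact k ^ 2 * (k + 1) * ((k + 1) * (2 * (k + 1) choose (k + 1))) = fact (2 * (k + 1))"
    unfolding factorial_binomial2 [symmetric] fact_Suc_power by algebra
  also have "\<dots> = (2 * k + 2) * (2 * k + 1) * fact (2 * k)" by (simp add: algebra_simps)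
  also have "\<dots> = fact k ^ 2 * (k + 1) * (2 * (2 * k + 1) * (2 * k choose k))"
    unfolding factorial_binomial2 [symmetric] by algebra
  finally show ?thesis by simp
qed

lemma binomial3_rec:
  "(k + 1)^2 * ((3 * (k + 1) choose (k + 1)) * (2 * (k + 1) choose (k + 1)))
     = 3 * (3 * k + 1) * (3 * k + 2) * ((3 * k choose k) * (2 * k choose k))" (is "_ * ?a = _ * ?b")
proof -
  have "fact k ^ 3 * (k + 1) * ((k + 1)^2 * ?a) = fact (3 * (k + 1))"
    unfolding factorial_binomial3 [symmetric] fact_Suc_power by algebra
  also have "\<dots> = (3 * k + 3) * (3 * k + 2) * (3 * k + 1) * fact (3 * k)"
    using fact_add_3 [of "3 * k"] by (simp add: algebra_simps)
  also have "\<dots> = fact k ^ 3 * (k + 1) * (3 * (3 * k + 1) * (3 * k + 2) * ?b)"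
    unfolding factorial_binomial3 [symmetric] by algebra
  finally show ?thesis by simp
qed

lemma binomial4_rec:
  "(k + 1)^3 * ((4 * (k + 1) choose (k + 1)) * (3 * (k + 1) choose (k + 1)) * (2 * (k + 1) choose (k + 1)))
     = 8 * (2 * k + 1) * (4 * k + 1) * (4 * k + 3)
        * ((4 * k choose k) * (3 * k choose k) * (2 * k choose k))" (is "_ * ?a = _ * ?b")
proof -
  have "fact k ^ 4 * (k + 1) * ((k + 1)^3 * ?a) = fact (4 * (k + 1))"
    unfolding factorial_binomial4 [symmetric] fact_Suc_power by algebra
  also have "\<dots> = (4 * k + 4) * (4 * k + 3) * (4 * k + 2) * (4 * k + 1) * fact (4 * k)"
    using fact_add_4 [of "4 * k"] by (simp add: algebra_simps)
  also have "\<dots> = fact k ^ 4 * (k + 1) * (8 * (2 * k + 1) * (4 * k + 1) * (4 * k + 3) * ?b)"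
    unfolding factorial_binomial4 [symmetric] by algebra
  finally show ?thesis by simp
qed

text \<open>\<open>trinom\<close> and \<open>quadrinom\<close> are the sums of \<open>(3 k)! / k!^3 * X^k\<close> and \<open>(4 k)! / k!^4 * X^k\<close>;
the multinomial coefficients are written as products of binomial coefficients because
integrality is then evident.\<close>

definition trinom :: "int fps" where
  "trinom = Abs_fps (\<lambda>k. int ((3 * k choose k) * (2 * k choose k)))"

definition sqbinom :: "int fps" where
  "sqbinom = Abs_fps (\<lambda>k. int ((2 * k choose k)^2))"

definition quadrinom :: "int fps" where
  "quadrinom = Abs_fps (\<lambda>k. int ((4 * k choose k) * (3 * k choose k) * (2 * k choose k)))"

lemma trinom_rec: "(int n + 1)^2 * trinom $ (n + 1) = (27 * int n^2 + 27 * int n + 6) * trinom $ n"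
  using arg_cong [OF binomial3_rec [of n], of int]
  by (simp add: trinom_def algebra_simps power2_eq_square)

lemma sqbinom_rec: "(int n + 1)^2 * sqbinom $ (n + 1) = (16 * int n^2 + 16 * int n + 4) * sqbinom $ n"
  using arg_cong [OF binomial2_rec [of n], of "\<lambda>k. int (k^2)"]
  by (simp add: sqbinom_def algebra_simps power2_eq_square)

lemma quadrinom_rec: "(int n + 1)^3 * quadrinom $ (n + 1)
    = (256 * int n^3 + 384 * int n^2 + 176 * int n + 24) * quadrinom $ n"
  using arg_cong [OF binomial4_rec [of n], of int]
  by (simp add: quadrinom_def algebra_simps power2_eq_square power3_eq_cube)

lemma series_nth_0 [simp]: "trinom $ 0 = 1" "sqbinom $ 0 = 1" "quadrinom $ 0 = 1"
  by (simp_all add: trinom_def sqbinom_def quadrinom_def)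

lemma of_int_fps_dvd_iff: "of_int c dvd (f :: int fps) \<longleftrightarrow> (\<forall>n. c dvd f $ n)"
proof
  assume "\<forall>n. c dvd f $ n"
  then have "f = of_int c * Abs_fps (\<lambda>n. f $ n div c)" by (simp add: fps_eq_iff)
  then show "of_int c dvd f" by (metis dvd_triv_left)
qed (auto simp: dvd_def)

lemma trinom_cong: "6 dvd trinom - 1"
proof -
  have "6 dvd (trinom - 1) $ k" for k
  proof (cases "k = 0")
    case False
    then show ?thesis by (simp add: trinom_def choose_multiple)
  qed simp
  then show ?thesis using of_int_fps_dvd_iff [of 6] by simp
qed

lemma sqbinom_cong: "4 dvd sqbinom - 1"
proof -
  have "4 dvd (sqbinom - 1) $ k" for k
  proof (cases "k = 0")
    case False
    then show ?thesis by (simp add: sqbinom_def choose_multiple power2_eq_square)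
  qed simp
  then show ?thesis using of_int_fps_dvd_iff [of 4] by simp
qed

lemma quadrinom_cong: "24 dvd quadrinom - 1"
proof -
  have "24 dvd (quadrinom - 1) $ k" for k
  proof (cases "k = 0")
    case False
    then show ?thesis by (simp add: quadrinom_def choose_multiple)
  qed simp
  then show ?thesis using of_int_fps_dvd_iff [of 24] by simp
qed

text \<open>The next five lemmas give generating functions of sequences A, C, F, B and E. In each case the binomial
transform at \<open>l\<close> removes the linear term, and its generating function in \<open>t\<close>, for A and C for instance
\<open>1 + 6 t^2 + 12 t^3 + 90 t^4 + ...\<close>, is the hypergeometric series at a cubic or quadratic
polynomial in \<open>t\<close>. The polynomials in \<open>t\<close> handed over are the images of \<open>r\<close> under the Euler operator.\<close>

lemma second_kind_A:
  "second_kind_rec 7 (- 8) 2 (fps_nth (geo 2 * (trinom oo geo_var 2 ^ 2 * (1 + 2 * geo_var 2))))"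
proof -
  define t where "t = geo_var 2"
  define q where "q = geo 2"
  have q: "q = 1 + 2 * t" by (simp add: q_def t_def geo_eq)
  have dq: "euler q = 2 * t * q" and dt: "euler t = t * q"
    by (simp_all add: q_def t_def euler_geo_var_form euler_geo_var)
  show ?thesis
  proof (rule second_kind_pullback [where \<kappa> = 27 and \<mu> = 6 and dr = "(2*t^2 + 6*t^3) * q"
        and ddr = "((4*t + 18*t^2) * q + (4*t^2 + 12*t^3)) * t * q" and M = "4*t^2 * (1 + 3*t) * q^2"])
    show "(geo_var 2 ^ 2 * (1 + 2 * geo_var 2)) $ 0 = 0" by (simp add: geo_var_def)
    show "euler (geo_var 2 ^ 2 * (1 + 2 * geo_var 2)) = (2*t^2 + 6*t^3) * q"
      unfolding t_def [symmetric] by (simp add: dt dq euler_rules; simp add: q; algebra)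
    show "euler ((2*t^2 + 6*t^3) * q) = ((4*t + 18*t^2) * q + (4*t^2 + 12*t^3)) * t * q"
      by (simp add: dt dq euler_rules; simp add: q; algebra)
  qed (simp, (use trinom_rec in simp), (unfold q_def [symmetric] t_def [symmetric] of_int_minus of_int_numeral q, algebra+))
qed

lemma second_kind_C:
  "second_kind_rec 10 9 3 (fps_nth (geo 3 * (trinom oo geo_var 3 ^ 2 * (1 + 2 * geo_var 3))))"
proof -
  define t where "t = geo_var 3"
  define q where "q = geo 3"
  have q: "q = 1 + 3 * t" by (simp add: q_def t_def geo_eq)
  have dq: "euler q = 3 * t * q" and dt: "euler t = t * q"
    by (simp_all add: q_def t_def euler_geo_var_form euler_geo_var)
  show ?thesis
  proof (rule second_kind_pullback [where \<kappa> = 27 and \<mu> = 6 and dr = "(2*t^2 + 6*t^3) * q"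
        and ddr = "((4*t + 18*t^2) * q + (6*t^2 + 18*t^3)) * t * q" and M = "4*t^2 * q^3"])
    show "(geo_var 3 ^ 2 * (1 + 2 * geo_var 3)) $ 0 = 0" by (simp add: geo_var_def)
    show "euler (geo_var 3 ^ 2 * (1 + 2 * geo_var 3)) = (2*t^2 + 6*t^3) * q"
      unfolding t_def [symmetric] by (simp add: dt dq euler_rules; simp add: q; algebra)
    show "euler ((2*t^2 + 6*t^3) * q) = ((4*t + 18*t^2) * q + (6*t^2 + 18*t^3)) * t * q"
      by (simp add: dt dq euler_rules; simp add: q; algebra)
  qed (simp, (use trinom_rec in simp), (unfold q_def [symmetric] t_def [symmetric] of_int_minus of_int_numeral q, algebra+))
qed

lemma second_kind_F:
  "second_kind_rec 17 72 6 (fps_nth (geo 6 * (trinom oo geo_var 6 ^ 2 * (1 - 2 * geo_var 6))))"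
proof -
  define t where "t = geo_var 6"
  define q where "q = geo 6"
  have q: "q = 1 + 6 * t" by (simp add: q_def t_def geo_eq)
  have dq: "euler q = 6 * t * q" and dt: "euler t = t * q"
    by (simp_all add: q_def t_def euler_geo_var_form euler_geo_var)
  show ?thesis
  proof (rule second_kind_pullback [where \<kappa> = 27 and \<mu> = 6 and dr = "(2*t^2 - 6*t^3) * q"
        and ddr = "((4*t - 18*t^2) * q + (12*t^2 - 36*t^3)) * t * q" and M = "4*t^2 * (1 - 3*t) * q^2"])
    show "(geo_var 6 ^ 2 * (1 - 2 * geo_var 6)) $ 0 = 0" by (simp add: geo_var_def)
    show "euler (geo_var 6 ^ 2 * (1 - 2 * geo_var 6)) = (2*t^2 - 6*t^3) * q"
      unfolding t_def [symmetric] by (simp add: dt dq euler_rules; simp add: q; algebra)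
    show "euler ((2*t^2 - 6*t^3) * q) = ((4*t - 18*t^2) * q + (12*t^2 - 36*t^3)) * t * q"
      by (simp add: dt dq euler_rules; simp add: q; algebra)
  qed (simp, (use trinom_rec in simp), (unfold q_def [symmetric] t_def [symmetric] of_int_minus of_int_numeral q, algebra+))
qed

lemma second_kind_B:
  "second_kind_rec 9 27 3 (fps_nth (geo 3 * (trinom oo - (geo_var 3 ^ 3))))"
proof -
  define t where "t = geo_var 3"
  define q where "q = geo 3"
  have q: "q = 1 + 3 * t" by (simp add: q_def t_def geo_eq)
  have dq: "euler q = 3 * t * q" and dt: "euler t = t * q"
    by (simp_all add: q_def t_def euler_geo_var_form euler_geo_var)
  show ?thesis
  proof (rule second_kind_pullback [where \<kappa> = 27 and \<mu> = 6 and dr = "- (3*t^3 * q)"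
        and ddr = "- (9*t^3*q^2 + 9*t^4*q)" and M = "- (9*t^3 * q^2)"])
    show "(- (geo_var 3 ^ 3)) $ 0 = 0" by (simp add: geo_var_def)
    show "euler (- (geo_var 3 ^ 3)) = - (3*t^3 * q)"
      unfolding t_def [symmetric] by (simp add: dt dq euler_rules; simp add: q; algebra)
    show "euler (- (3*t^3 * q)) = - (9*t^3*q^2 + 9*t^4*q)"
      by (simp add: dt dq euler_rules; simp add: q; algebra)
  qed (simp, (use trinom_rec in simp), (unfold q_def [symmetric] t_def [symmetric] of_int_minus of_int_numeral q, algebra+))
qed

lemma second_kind_E:
  "second_kind_rec 12 32 4 (fps_nth (geo 4 * (sqbinom oo geo_var 4 ^ 2)))"
proof -
  define t where "t = geo_var 4"
  define q where "q = geo 4"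
  have q: "q = 1 + 4 * t" by (simp add: q_def t_def geo_eq)
  have dq: "euler q = 4 * t * q" and dt: "euler t = t * q"
    by (simp_all add: q_def t_def euler_geo_var_form euler_geo_var)
  show ?thesis
  proof (rule second_kind_pullback [where \<kappa> = 16 and \<mu> = 4 and dr = "2*t^2 * q"
        and ddr = "4*t^2*q^2 + 8*t^3*q" and M = "4*t^2 * q^2"])
    show "(geo_var 4 ^ 2) $ 0 = 0" by (simp add: geo_var_def)
    show "euler (geo_var 4 ^ 2) = 2*t^2 * q"
      unfolding t_def [symmetric] by (simp add: dt dq euler_rules; simp add: q; algebra)
    show "euler (2*t^2 * q) = 4*t^2*q^2 + 8*t^3*q"
      by (simp add: dt dq euler_rules; simp add: q; algebra)
  qed (simp, (use sqbinom_rec in simp), (unfold q_def [symmetric] t_def [symmetric] of_int_minus of_int_numeral q, algebra+))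
qed

section \<open>Pullbacks of hypergeometric series of order three\<close>

lemma quadrinom_ode: "euler (euler (euler quadrinom)) = fps_X * (256 * euler (euler (euler quadrinom))
    + 384 * euler (euler quadrinom) + 176 * euler quadrinom + 24 * quadrinom)" (is "?L = ?R")
proof (rule fps_ext)
  fix n show "?L $ n = ?R $ n"
  proof (cases n)
    case (Suc m)
    then show ?thesis using quadrinom_rec [of m]
      by (simp add: euler_nth power3_eq_cube power2_eq_square) (simp add: algebra_simps)
  qed (simp add: euler_nth)
qed

text \<open>As for order two, the differential equation of \<open>P * (quadrinom oo r)\<close>, multiplied by \<open>q^2\<close>, is a multiple \<open>M\<close> of
the hypergeometric equation at \<open>r\<close>, and the hypotheses \<open>c3\<close> to \<open>c0\<close> compare the coefficients of the
four iterated images of \<open>quadrinom\<close> under the Euler operator. The prefactor \<open>P\<close> enters only through its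
logarithmic derivative \<open>p0\<close>, so that it may be an algebraic function. The multiplier \<open>s\<close> clears
the denominator of \<open>r\<close> when \<open>r\<close> is not a polynomial in \<open>t\<close>.\<close>

lemma first_kind_pullback:
  fixes P r :: "int fps" and m :: int
  defines "t \<equiv> geo_var m" and "q \<equiv> geo m"
  assumes r0: "r $ 0 = 0" and P0: "P $ 0 = 1" and s: "s * r = \<sigma>"
    and dP: "euler P = p0 * P" "euler p0 = p1" "euler p1 = p2"
    and dr: "euler r = e0 * r" "euler e0 = e1" "euler e1 = e2"
    and W: "W = q^2 - of_int (2 * a) * t * q + of_int c * t^2"
    and V2: "V2 = of_int (3 * c) * t^2 - of_int (3 * a) * t * q"
    and V1: "V1 = of_int (3 * c + d) * t^2 - of_int (a + 2 * b) * t * q"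
    and V0: "V0 = of_int (c + d) * t^2 - of_int b * t * q"
    and c3: "W * e0^3 = M * (s - 256 * \<sigma>)"
    and c2: "W * (3 * p0 * e0^2 + 3 * e0 * e1) + V2 * e0^2 = - 384 * M * \<sigma>"
    and c1: "W * (3 * p0^2 * e0 + 3 * p0 * e1 + 3 * p1 * e0 + e2) + V2 * (2 * p0 * e0 + e1) + V1 * e0
               = - 176 * M * \<sigma>"
    and c0: "W * (p0^3 + 3 * p0 * p1 + p2) + V2 * (p0^2 + p1) + V1 * p0 + V0 = - 24 * M * \<sigma>"
  shows "first_kind_rec a b c d (fps_nth (P * (quadrinom oo r)))"
proof -
  define y0 y1 y2 y3 where "y0 = quadrinom oo r" and "y1 = euler quadrinom oo r" and "y2 = euler (euler quadrinom) oo r"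
    and "y3 = euler (euler (euler quadrinom)) oo r"
  have X: "fps_X oo r = r" using r0 by simp
  have dy: "euler y0 = e0 * y1" "euler y1 = e0 * y2" "euler y2 = e0 * y3"
    unfolding y0_def y1_def y2_def y3_def using euler_compose [OF r0 dr(1)] by blast+
  have "y3 = r * (256 * y3 + 384 * y2 + 176 * y1 + 24 * y0)"
    using arg_cong [OF quadrinom_ode, of "\<lambda>f. f oo r"] unfolding fps_compose_mult_distrib [OF r0] X
      fps_compose_add_distrib y0_def [symmetric] y1_def [symmetric] y2_def [symmetric]
      y3_def [symmetric] numeral_compose .
  then have y3: "s * y3 = \<sigma> * (256 * y3 + 384 * y2 + 176 * y1 + 24 * y0)"
    unfolding s [symmetric] mult.assoc by (rule arg_cong)
  define F F1 F2 F3 where "F = P * y0" and "F1 = euler F" and "F2 = euler F1" and "F3 = euler F2"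
  have F1: "F1 = P * (p0 * y0 + e0 * y1)"
    by (simp add: F1_def F_def euler_rules dP dy algebra_simps)
  have F2: "F2 = P * ((p0^2 + p1) * y0 + (2 * p0 * e0 + e1) * y1 + e0^2 * y2)"
    by (simp add: F2_def F1 euler_rules dP dr dy algebra_simps power2_eq_square)
  have F3: "F3 = P * ((p0^3 + 3 * p0 * p1 + p2) * y0
      + (3 * p0^2 * e0 + 3 * p0 * e1 + 3 * p1 * e0 + e2) * y1
      + (3 * p0 * e0^2 + 3 * e0 * e1) * y2 + e0^3 * y3)"
    unfolding F3_def F2 by (simp add: euler_rules dP dr dy; algebra)
  have "q^2 * F3 - t * q * (of_int (2*a) * F3 + of_int (3*a) * F2 + of_int (a + 2*b) * F1 + of_int b * F)
       + t^2 * (of_int c * (F3 + 3 * F2 + 3 * F1 + F) + of_int d * (F1 + F))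
      = P * ((W * (p0^3 + 3 * p0 * p1 + p2) + V2 * (p0^2 + p1) + V1 * p0 + V0) * y0
        + (W * (3 * p0^2 * e0 + 3 * p0 * e1 + 3 * p1 * e0 + e2) + V2 * (2 * p0 * e0 + e1) + V1 * e0) * y1
        + (W * (3 * p0 * e0^2 + 3 * e0 * e1) + V2 * e0^2) * y2 + (W * e0^3) * y3)"
    unfolding F3 F2 F1 F_def W V2 V1 V0 by (simp; algebra)
  also have "\<dots> = P * M * (s * y3 - \<sigma> * (256 * y3 + 384 * y2 + 176 * y1 + 24 * y0))"
    unfolding c3 c2 c1 c0 by algebra
  also have "\<dots> = 0" by (simp add: y3)
  finally have "q^2 * (F3 - fps_X * (of_int (2*a) * F3 + of_int (3*a) * F2 + of_int (a + 2*b) * F1 + of_int b * F)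
       + fps_X^2 * (of_int c * (F3 + 3 * F2 + 3 * F1 + F) + of_int d * (F1 + F))) = 0"
    unfolding t_def q_def geo_var_def by algebra
  then have "F3 = fps_X * (of_int (2*a) * F3 + of_int (3*a) * F2 + of_int (a + 2*b) * F1 + of_int b * F)
       - fps_X^2 * (of_int c * (F3 + 3 * F2 + 3 * F1 + F) + of_int d * (F1 + F))"
    using geo_nonzero [of m] by (simp add: q_def del: of_int_mult of_int_add) algebra
  moreover have "F $ 0 = 1" by (simp add: F_def y0_def P0)
  ultimately have "first_kind_rec a b c d (fps_nth F)"
    unfolding first_kind_rec_iff fps_nth_inverse Let_def F3_def F2_def F1_def by blast
  then show ?thesis unfolding F_def y0_def .
qed

text \<open>For the sequence \<open>\<epsilon>\<close> the argument \<open>t^2 q^2 = X^2 / (1 - 4 X)^4\<close> can be read off from the binomial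
transform at 4, which begins with \<open>1, 0, 24, 192, 2904\<close>.\<close>

lemma first_kind_epsilon:
  "first_kind_rec 12 4 16 0 (fps_nth (geo 4 * (quadrinom oo geo_var 4 ^ 2 * geo 4 ^ 2)))"
proof -
  define t where "t = geo_var 4"
  define q where "q = geo 4"
  have q: "q = 1 + 4 * t" by (simp add: q_def t_def geo_eq)
  have dq: "euler q = 4 * t * q" and dt: "euler t = t * q"
    by (simp_all add: q_def t_def euler_geo_var_form euler_geo_var)
  have "first_kind_rec 12 4 16 0 (fps_nth (q * (quadrinom oo t^2 * q^2)))"
  proof (rule first_kind_pullback [where m = 4 and s = 1 and M = "8 * (1 + 8 * t)"])
    show "euler q = (4 * t) * q" by (rule dq)
    show "euler (4 * t) = 4 * t * q" by (simp add: euler_rules dt)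
    show "euler (4 * t * q) = 4 * t * q^2 + 16 * t^2 * q"
      by (simp add: euler_rules dt dq algebra_simps power2_eq_square)
    show "euler (t^2 * q^2) = (2 + 16 * t) * (t^2 * q^2)"
      by (simp add: euler_rules dt dq; simp add: q; algebra)
    show "euler (2 + 16 * t) = 16 * t * q" by (simp add: euler_rules dt)
    show "euler (16 * t * q) = 16 * t * q^2 + 64 * t^2 * q"
      by (simp add: euler_rules dt dq algebra_simps power2_eq_square)
  qed (simp add: t_def geo_var_def, simp add: q_def, rule mult_1, (rule refl)+,
       (unfold q_def [symmetric] t_def [symmetric], (simp add: q; algebra)+))
  then show ?thesis by (simp only: t_def q_def)
qed

text \<open>This is the expansion of \<open>(1 - 12 X)^(-1/2)\<close>. It is the prefactor for the sequence \<open>s_18\<close>, whose first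
terms 1, 6, 54 agree with it and whose next term exceeds it by 24.\<close>

definition inv_sqrt :: "int fps" where "inv_sqrt = Abs_fps (\<lambda>n. int (2 * n choose n) * 3 ^ n)"

lemma euler_inv_sqrt: "euler inv_sqrt = 6 * geo_var 12 * inv_sqrt"
proof -
  have "(1 - of_int 12 * fps_X) * euler inv_sqrt = 6 * fps_X * inv_sqrt"
  proof (rule fps_ext)
    fix n
    have "(euler inv_sqrt - 12 * (fps_X * euler inv_sqrt)) $ n = (6 * (fps_X * inv_sqrt)) $ n"
    proof (cases n)
      case (Suc k)
      have "int (k + 1) * inv_sqrt $ (k + 1)
          = int (k + 1) * int (2 * (k + 1) choose (k + 1)) * (3 * 3 ^ k)"
        by (simp only: inv_sqrt_def fps_nth_Abs_fps power_add power_one_right mult.assoc mult.commute [of 3])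
      also have "int (k + 1) * int (2 * (k + 1) choose (k + 1)) = 2 * (2 * int k + 1) * int (2 * k choose k)"
        using arg_cong [OF binomial2_rec [of k], of int] by (simp add: algebra_simps)
      also have "\<dots> * (3 * 3 ^ k) = 6 * (2 * int k + 1) * inv_sqrt $ k"
        by (simp add: inv_sqrt_def)
      finally have "int (k + 1) * inv_sqrt $ (k + 1) = 6 * (2 * int k + 1) * inv_sqrt $ k" .
      then show ?thesis using Suc by (simp add: euler_nth algebra_simps)
    qed (simp add: euler_nth)
    then show "((1 - of_int 12 * fps_X) * euler inv_sqrt) $ n = (6 * fps_X * inv_sqrt) $ n"
      by (simp add: algebra_simps)
  qed
  then have "((1 - of_int 12 * fps_X) * geo 12) * euler inv_sqrt = 6 * geo_var 12 * inv_sqrt"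
    unfolding geo_var_def by algebra
  then show ?thesis by (simp only: geo_inverse mult_1)
qed

lemma inv_sqrt_cong: "6 dvd inv_sqrt - 1"
proof -
  have "6 dvd (inv_sqrt - 1) $ k" for k
  proof (cases "k = 0")
    case False
    then have "(3::int) ^ k = 3 * 3 ^ (k - 1)" by (simp add: power_eq_if)
    then show ?thesis using False by (simp add: inv_sqrt_def choose_multiple)
  qed (simp add: inv_sqrt_def)
  then show ?thesis using of_int_fps_dvd_iff [of 6] by simp
qed

text \<open>Here \<open>r = X^3 / (1 - 12 X)^2 = X t^2\<close> equals \<open>t^3 / q\<close>, whence the multiplier \<open>q\<close>.\<close>

lemma first_kind_s18:
  "first_kind_rec 14 6 192 (- 12) (fps_nth (inv_sqrt * (quadrinom oo fps_X * geo_var 12 ^ 2)))"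
proof -
  define t where "t = geo_var 12"
  define q where "q = geo 12"
  have q: "q = 1 + 12 * t" by (simp add: q_def t_def geo_eq)
  have dq: "euler q = 12 * t * q" and dt: "euler t = t * q"
    by (simp_all add: q_def t_def euler_geo_var_form euler_geo_var)
  have "first_kind_rec 14 6 192 (- 12) (fps_nth (inv_sqrt * (quadrinom oo fps_X * t^2)))"
  proof (rule first_kind_pullback [where m = 12 and s = q and M = "27 * (1 + 8 * t)"])
    show "q * (fps_X * t^2) = t^3"
      by (simp add: q_def t_def geo_var_def power3_eq_cube power2_eq_square algebra_simps)
    show "euler inv_sqrt = (6 * t) * inv_sqrt" by (simp add: euler_inv_sqrt t_def)
    show "euler (6 * t) = 6 * t * q" by (simp add: euler_rules dt)
    show "euler (6 * t * q) = 6 * t * q^2 + 72 * t^2 * q"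
      by (simp add: euler_rules dt dq algebra_simps power2_eq_square)
    show "euler (fps_X * t^2) = (3 + 24 * t) * (fps_X * t^2)"
      by (simp add: euler_rules dt dq; simp add: q; algebra)
    show "euler (3 + 24 * t) = 24 * t * q" by (simp add: euler_rules dt)
    show "euler (24 * t * q) = 24 * t * q^2 + 288 * t^2 * q"
      by (simp add: euler_rules dt dq algebra_simps power2_eq_square)
  qed (simp, simp add: inv_sqrt_def, (rule refl)+,
       (unfold q_def [symmetric] t_def [symmetric], (simp add: q; algebra)+))
  then show ?thesis by (simp only: t_def)
qed

section \<open>Symmetric squares\<close>

text \<open>In such an equation the coefficient of \<open>X^n\<close> in \<open>g\<close>, multiplied by \<open>n^3\<close>, is expressed by earlier coefficients.\<close>

lemma ode3_unique:
  fixes g :: "int fps"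
  assumes "euler (euler (euler g)) = fps_X * (s3 * euler (euler (euler g)) + s2 * euler (euler g)
             + s1 * euler g + s0 * g)" and "g $ 0 = 0"
  shows "g = 0"
proof -
  have "g $ n = 0" for n
  proof (induction n rule: less_induct)
    case (less n)
    show ?case
    proof (cases n)
      case 0 then show ?thesis using assms by simp
    next
      case (Suc m)
      have 0: "(a * b) $ m = 0" if "\<And>k. k \<le> m \<Longrightarrow> b $ k = 0" for a b :: "int fps"
        unfolding fps_mult_nth using that by (intro sum.neutral) simp
      have "int n ^ 3 * g $ n = euler (euler (euler g)) $ n"
        by (simp add: euler_nth power3_eq_cube)
      also have "\<dots> = 0" using Suc less by (subst assms(1)) (simp add: 0 euler_nth)
      finally show ?thesis using Suc by simp
    qed
  qed
  then show ?thesis by (simp add: fps_eq_iff)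
qed

text \<open>Substituting a series \<open>w = \<plusminus> X + ...\<close> acts on coefficients by a triangular matrix with units on the diagonal.\<close>

lemma dvd_of_dvd_compose:
  fixes K w :: "int fps"
  assumes "of_int N dvd K oo w" and "w $ 0 = 0" and "is_unit (w $ 1)"
  shows "of_int N dvd K"
proof -
  have "N dvd K $ n" for n
  proof (induction n rule: less_induct)
    case (less n)
    have "(K oo w) $ n = (\<Sum>i<n. K $ i * (w ^ i) $ n) + K $ n * (w $ 1) ^ n"
      unfolding fps_compose_nth using startsby_zero_power_nth_same [OF assms(2), of n]
      by (simp add: lessThan_Suc_atMost [symmetric] atLeast0AtMost)
    moreover have "N dvd (\<Sum>i<n. K $ i * (w ^ i) $ n)"
      using less by (intro dvd_sum) auto
    moreover have "N dvd (K oo w) $ n" using assms(1) by (simp add: of_int_fps_dvd_iff)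
    ultimately have "N dvd K $ n * (w $ 1) ^ n" by (simp add: dvd_add_right_iff)
    then show ?case using assms(3) by (meson dvd_mult_unit_iff is_unit_power_iff dvd_trans
      dvd_mult_right is_unit_power_iff unit_dvdE dvd_mult_unit_iff')
  qed
  then show ?thesis by (simp add: of_int_fps_dvd_iff)
qed

text \<open>A series with constant term 1 is invertible over the integers: substitute into the geometric series.\<close>

lemma inverse_exists:
  assumes "(g :: int fps) $ 0 = 0" shows "\<exists>q. (1 - g) * q = 1"
proof
  have "((1 - of_int 1 * fps_X) * geo 1) oo g = 1" by (simp only: geo_inverse fps_compose_1)
  then show "(1 - g) * (geo 1 oo g) = 1"
    using assms by (simp add: fps_compose_mult_distrib fps_compose_sub_distrib)
qed

text \<open>This is the correspondence between sequences of the second kind and those of the first kind with \<open>d = 0\<close>.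
If \<open>f\<close> solves the second order equation, then \<open>f^2\<close> solves its symmetric square, of order three. The
equation of the first kind, pulled back along \<open>w = - X / Q\<close> and twisted by \<open>1 / Q\<close>, is that same equation,
essentially because \<open>1 - 2 a w + (a^2 - 4 c) w^2 = ((1 - c X^2) / Q)^2\<close>. Both solutions have constant term 1, so they
agree.\<close>

lemma symmetric_square:
  assumes u: "second_kind_rec a c l u" and v: "first_kind_rec a (a - 2 * l) (a^2 - 4 * c) 0 v"
    and Q: "Q = 1 - of_int a * fps_X + of_int c * fps_X^2" and q: "Q * q = 1"
  shows "Abs_fps v oo - (fps_X * q) = Q * Abs_fps u ^ 2"
proof -
  define z :: "int fps" where "z = fps_X"
  define A B L where "A = (of_int a :: int fps)" and "B = (of_int c :: int fps)" and "L = (of_int l :: int fps)"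
  define p1 p0 s where "p1 = A * z - 2 * B * z^2" and "p0 = L * z - B * z^2" and "s = 1 - B * z^2"
  have const: "euler A = 0" "euler B = 0" "euler L = 0" by (simp_all add: A_def B_def L_def)
  have dz: "euler z = z" by (simp add: z_def)
  have Q: "Q = 1 - A * z + B * z^2" using assms by (simp add: A_def B_def z_def)
  have dp1: "euler p1 = A * z - 4 * B * z^2" and dp0: "euler p0 = L * z - 2 * B * z^2"
    and ds: "euler s = - 2 * B * z^2" and dQ: "euler Q = - p1"
    unfolding p1_def p0_def s_def Q by (simp_all add: euler_rules const dz algebra_simps power2_eq_square)
  \<comment> \<open>The symmetric square: an equation of order three for \<open>g = f^2\<close>, namely \<open>G\<close> below.\<close>
  define f where "f = Abs_fps u"
  define f1 f2 where "f1 = euler f" and "f2 = euler f1"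
  have "f2 = z * (A * f2 + A * f1 + L * f) - z^2 * (B * (f2 + 2 * f1 + f))"
    using u unfolding second_kind_rec_iff Let_def f1_def f2_def f_def z_def A_def B_def L_def by blast
  then have f2: "Q * f2 = p1 * f1 + p0 * f" unfolding Q p1_def p0_def by algebra
  define g where "g = f^2"
  define g1 g2 g3 where "g1 = euler g" and "g2 = euler g1" and "g3 = euler g2"
  have g1: "g1 = 2 * f * f1" by (simp add: g1_def g_def euler_rules f1_def)
  have g2: "g2 = 2 * f1^2 + 2 * f * f2"
    by (simp add: g2_def g1 euler_rules f1_def f2_def power2_eq_square algebra_simps)
  have Qg2: "Q * g2 = 2 * Q * f1^2 + p1 * g1 + 2 * p0 * g"
    unfolding g2 g1 g_def using f2 by algebra
  have "euler (Q * g2) = euler (2 * Q * f1^2 + p1 * g1 + 2 * p0 * g)" by (simp only: Qg2)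
  then have "- p1 * g2 + Q * g3 = - 2 * p1 * f1^2 + 4 * Q * f1 * f2 + euler p1 * g1 + p1 * g2
      + 2 * euler p0 * g + 2 * p0 * g1"
    by (simp add: euler_rules dQ g1_def [symmetric] g2_def [symmetric] g3_def [symmetric] f2_def [symmetric]
          f1_def [symmetric] algebra_simps)
  then have "Q * g3 = 2 * p1 * g2 + euler p1 * g1 + 2 * euler p0 * g + 4 * p0 * g1 + 2 * p1 * f1^2"
    using f2 g1 by algebra
  then have G: "Q^2 * g3 = 3 * Q * p1 * g2 + (Q * euler p1 + 4 * Q * p0 - p1^2) * g1
      + (2 * Q * euler p0 - 2 * p1 * p0) * g"
    using Qg2 by algebra
  \<comment> \<open>The pullback along \<open>w\<close>, whose logarithmic derivative is \<open>q * s\<close>.\<close>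
  define w where "w = - (z * q)"
  have w0: "w $ 0 = 0" by (simp add: w_def z_def)
  have "euler (Q * q) = 0" by (simp add: q)
  then have "Q * euler q = p1 * q" by (simp add: euler_rules dQ)
  then have dq: "euler q = q^2 * p1" using q by algebra
  have dw: "euler w = (q * s) * w"
  proof -
    have "euler w = w + w * q * p1" by (simp add: w_def euler_rules dz dq algebra_simps power2_eq_square)
    also have "\<dots> = w * q * (Q + p1)" using q by algebra
    also have "Q + p1 = s" by (simp add: Q p1_def s_def)
    finally show ?thesis by (simp add: algebra_simps)
  qed
  define F where "F = Abs_fps v"
  define y0 y1 y2 y3 where "y0 = F oo w" and "y1 = euler F oo w" and "y2 = euler (euler F) oo w"
    and "y3 = euler (euler (euler F)) oo w"
  have "Q * euler y0 = (Q * q) * s * y1" "Q * euler y1 = (Q * q) * s * y2" "Q * euler y2 = (Q * q) * s * y3"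
    unfolding y0_def y1_def y2_def y3_def euler_compose [OF w0 dw] by (simp_all add: algebra_simps)
  then have dy: "Q * euler y0 = s * y1" "Q * euler y1 = s * y2" "Q * euler y2 = s * y3"
    by (simp_all only: q mult_1)
  have X: "fps_X oo w = w" using w0 by simp
  have "euler (euler (euler F)) = fps_X * (of_int (2 * a) * euler (euler (euler F))
     + of_int (3 * a) * euler (euler F) + of_int (a + 2 * (a - 2 * l)) * euler F + of_int (a - 2 * l) * F)
     - fps_X ^ 2 * (of_int (a^2 - 4 * c) * (euler (euler (euler F)) + 3 * euler (euler F) + 3 * euler F + F)
     + of_int 0 * (euler F + F))"
    using v unfolding first_kind_rec_iff Let_def F_def by blast
  from arg_cong [OF this, of "\<lambda>f. f oo w"]
  have "y3 = w * (2 * A * y3 + 3 * A * y2 + (3 * A - 4 * L) * y1 + (A - 2 * L) * y0)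
     - w^2 * ((A^2 - 4 * B) * (y3 + 3 * y2 + 3 * y1 + y0))"
    unfolding fps_compose_mult_distrib [OF w0] X fps_compose_power [OF w0, symmetric]
      fps_compose_add_distrib fps_compose_sub_distrib y0_def [symmetric] y1_def [symmetric] y2_def [symmetric]
      y3_def [symmetric] numeral_compose fps_of_int [symmetric] fps_const_compose
    unfolding fps_of_int A_def B_def L_def by (simp add: algebra_simps)
  then have "Q^2 * y3 = - (z * Q * (2 * A * y3 + 3 * A * y2 + (3 * A - 4 * L) * y1 + (A - 2 * L) * y0))
     - z^2 * ((A^2 - 4 * B) * (y3 + 3 * y2 + 3 * y1 + y0))"
    using q unfolding w_def by algebra
  then have y3: "s^2 * y3 = - (z * Q * (3 * A * y2 + (3 * A - 4 * L) * y1 + (A - 2 * L) * y0))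
     - z^2 * ((A^2 - 4 * B) * (3 * y2 + 3 * y1 + y0))"
    unfolding s_def Q by algebra
  \<comment> \<open>The images of \<open>k = q * y0\<close> under the Euler operator have the form \<open>q^(i + 1) * n_i\<close>, where no power of \<open>q\<close>
    is left in \<open>n_i\<close>; multiplication by powers of \<open>Q\<close> then leaves polynomial identities.\<close>
  define k k1 k2 k3 where "k = q * y0" and "k1 = euler k" and "k2 = euler k1" and "k3 = euler k2"
  define n1 n2 where "n1 = p1 * y0 + s * y1"
    and "n2 = 2 * p1 * n1 + Q * (euler p1 * y0 + euler s * y1) + s * (p1 * y1 + s * y2)"
  have Qn1: "Q * euler n1 = Q * (euler p1 * y0 + euler s * y1) + s * (p1 * y1 + s * y2)"
    using dy unfolding n1_def euler_rules by algebra
  have Qn2: "Q * euler n2 = 2 * Q * euler p1 * n1 + 2 * p1 * (Q * euler n1)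
     + Q * (- p1 * (euler p1 * y0 + euler s * y1) + Q * (euler (euler p1) * y0 + euler (euler s) * y1)
            + euler p1 * s * y1 + euler s * s * y2)
     + Q * euler s * (p1 * y1 + s * y2)
     + s * (Q * euler p1 * y1 + p1 * s * y2 + Q * euler s * y2 + s * s * y3)"
    using dy dQ unfolding n2_def by (simp add: euler_rules; algebra)
  have k1: "k1 = q^2 * n1"
  proof -
    have "k1 = q^2 * p1 * y0 + q * (Q * q) * euler y0" by (simp add: k1_def k_def euler_rules dq q)
    then show ?thesis using dy(1) unfolding n1_def by algebra
  qed
  have k2: "k2 = q^3 * n2"
  proof -
    have "k2 = 2 * q * (q^2 * p1) * n1 + q^2 * (Q * q) * euler n1" by (simp add: k2_def k1 euler_rules dq q)
    then show ?thesis using Qn1 unfolding n2_def by algebra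
  qed
  have k3: "k3 = q^4 * (3 * p1 * n2 + Q * euler n2)"
  proof -
    have "k3 = 3 * q^2 * (q^2 * p1) * n2 + q^3 * (Q * q) * euler n2" by (simp add: k3_def k2 euler_rules dq q)
    then show ?thesis by algebra
  qed
  have "Q * euler n2 = (Q * euler p1 + 4 * Q * p0 - p1^2) * n1 + Q * (2 * Q * euler p0 - 2 * p1 * p0) * y0"
    (is "_ = ?R")
  proof -
    have ddp1: "euler (euler p1) = A * z - 8 * B * z^2" and dds: "euler (euler s) = - 4 * B * z^2"
      by (simp_all add: dp1 ds euler_rules const dz algebra_simps power2_eq_square)
    have "Q * euler n2 - ?R = s * (s^2 * y3 + (z * Q * (3 * A * y2 + (3 * A - 4 * L) * y1 + (A - 2 * L) * y0))
     + z^2 * ((A^2 - 4 * B) * (3 * y2 + 3 * y1 + y0)))"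
      unfolding Qn2 unfolding Qn1 unfolding ddp1 dds unfolding dp1 ds dp0 n1_def unfolding p1_def p0_def s_def Q by algebra
    then show ?thesis by (simp add: y3)
  qed
  then have K: "Q^2 * k3 = 3 * Q * p1 * k2 + (Q * euler p1 + 4 * Q * p0 - p1^2) * k1
      + (2 * Q * euler p0 - 2 * p1 * p0) * k"
    unfolding k3 k2 k1 k_def using q by algebra
  have "k - g = 0"
  proof (rule ode3_unique)
    have "euler (k - g) = k1 - g1" "euler (euler (k - g)) = k2 - g2" "euler (euler (euler (k - g))) = k3 - g3"
      by (simp_all add: euler_rules k1_def k2_def k3_def g1_def g2_def g3_def)
    \<comment> \<open>The leading coefficient \<open>Q^2\<close> is \<open>1\<close> plus a multiple of \<open>X\<close>; the rest moves to the right.\<close>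
    moreover have "k3 - g3 = z * ((2 * A - (2 * B + A^2) * z + 2 * A * B * z^2 - B^2 * z^3) * (k3 - g3)
        + (3 * Q * (A - 2 * B * z)) * (k2 - g2)
        + (Q * (A - 4 * B * z) + 4 * Q * (L - B * z) - z * (A - 2 * B * z)^2) * (k1 - g1)
        + (2 * Q * (L - 2 * B * z) - 2 * p1 * (L - B * z)) * (k - g))"
      using K G unfolding dp1 dp0 unfolding Q p1_def p0_def by algebra
    ultimately show "euler (euler (euler (k - g))) = fps_X * ((2 * A - (2 * B + A^2) * z + 2 * A * B * z^2 - B^2 * z^3) * euler (euler (euler (k - g)))
        + (3 * Q * (A - 2 * B * z)) * euler (euler (k - g))
        + (Q * (A - 4 * B * z) + 4 * Q * (L - B * z) - z * (A - 2 * B * z)^2) * euler (k - g)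
        + (2 * Q * (L - 2 * B * z) - 2 * p1 * (L - B * z)) * (k - g))"
      by (simp only: z_def)
    have "q $ 0 = 1" using arg_cong [OF q, of "\<lambda>f. f $ 0"] by (simp add: Q z_def power2_eq_square)
    then show "(k - g) $ 0 = 0" using u v
      by (simp add: k_def g_def y0_def F_def f_def second_kind_rec_def first_kind_rec_def power2_eq_square)
  qed
  then have "y0 = Q * g" using q unfolding k_def by algebra
  then show ?thesis by (simp add: y0_def g_def F_def f_def w_def z_def)
qed

section \<open>Three binomial sums\<close>

text \<open>Zeilberger's method: if the recurrence applied to the summand is the difference \<open>G (k + 1) - G k\<close> with \<open>G\<close> vanishing at
both ends, then the sum satisfies the recurrence. In the three applications below, \<open>G\<close> is the summand times a
rational function whose unknown numerator is determined by linear equations for its coefficients.\<close>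

lemma creative_telescoping:
  fixes T :: "nat \<Rightarrow> nat \<Rightarrow> nat" and G :: "nat \<Rightarrow> real" and p q r :: int
  assumes T: "\<And>m k. m < k \<Longrightarrow> T m k = 0"
    and G: "\<And>k. p * real (T (n + 1) k) + q * real (T n k) + r * real (T (n - 1) k) = G (k + 1) - G k"
    and "G 0 = 0" "G (n + 2) = 0"
  shows "p * int (\<Sum>k\<le>n+1. T (n + 1) k) + q * int (\<Sum>k\<le>n. T n k)
           + r * int (\<Sum>k\<le>n-1. T (n - 1) k) = 0"
proof -
  have ext: "(\<Sum>k\<le>m. T m k) = (\<Sum>k<n+2. T m k)" if "m \<le> n + 1" for m
    by (rule sum.mono_neutral_left) (use T that in auto)
  have "(\<Sum>k<n+2. p * real (T (n + 1) k) + q * real (T n k) + r * real (T (n - 1) k)) = 0"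
    unfolding G using assms sum_lessThan_telescope [of G "n + 2"] by simp
  then have "real_of_int (p * int (\<Sum>k\<le>n+1. T (n + 1) k) + q * int (\<Sum>k\<le>n. T n k)
           + r * int (\<Sum>k\<le>n-1. T (n - 1) k)) = 0"
    unfolding ext [OF le_refl] ext [OF le_add1] ext [OF le_trans [OF diff_le_self le_add1]]
    by (simp add: sum.distrib sum_distrib_left del: sum.lessThan_Suc)
  then show ?thesis by (simp only: of_int_eq_0_iff)
qed

lemma binomial_lower: "(real m + 1) * real (m choose k) = (real m + 1 - real k) * real (m + 1 choose k)"
proof (cases "k \<le> m + 1")
  case True
  show ?thesis using arg_cong [OF binomial_absorb_comp [of "m + 1" k], of real]
    unfolding of_nat_mult of_nat_diff [OF True] by (simp add: add.commute)
qed (simp add: binomial_eq_0)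

lemma binomial_step: "(real k + 1) * real (m choose (k + 1)) = (real m - real k) * real (m choose k)"
proof (cases "k \<le> m")
  case True
  have "Suc k * (m choose Suc k) = (m - k) * (m choose k)"
    using binomial_absorption [of k m] binomial_absorb_comp [of m k] by simp
  from arg_cong [OF this, of real] show ?thesis
    unfolding of_nat_mult of_nat_diff [OF True] by (simp add: add.commute)
qed (simp add: binomial_eq_0)

text \<open>To compare summands for \<open>n - 1\<close>, \<open>n\<close>, \<open>n + 1\<close> and for \<open>k\<close>, \<open>k + 1\<close>, all binomial coefficients that occur are expressed as
polynomials times one common quantity. The identities hold for every \<open>k\<close>, with no exceptions at the boundary
of the range of summation, and they turn the verification of a certificate into a polynomial identity. The next two
lemmas serve the same purpose for the other two binomial factors.\<close>

lemma binomial_reduced: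
  fixes n k :: nat
  assumes "n > 0"
  obtains c c' :: real where "real (n + 1 choose k) = real n * (real n + 1) * c"
    "real (n choose k) = real n * (real n + 1 - real k) * c"
    "real (n - 1 choose k) = (real n - real k) * (real n + 1 - real k) * c"
    "real (n + 1 choose (k + 1)) = real n * (real n + 1) * c'"
    "(real k + 1) * c' = (real n + 1 - real k) * c"
proof
  define c where "c = real (n + 1 choose k) / (real n * (real n + 1))"
  define c' where "c' = real (n + 1 choose (k + 1)) / (real n * (real n + 1))"
  have pos: "real n > 0" using assms by simp
  show 1: "real (n + 1 choose k) = real n * (real n + 1) * c"
    "real (n + 1 choose (k + 1)) = real n * (real n + 1) * c'"
    using pos by (simp_all add: c_def c'_def)
  have "(real n + 1) * real (n choose k) = (real n + 1) * (real n * (real n + 1 - real k) * c)"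
    using binomial_lower [of n k] unfolding 1 by (simp add: algebra_simps)
  then show 2: "real (n choose k) = real n * (real n + 1 - real k) * c" using pos by simp
  have "real n * real (n - 1 choose k) = real n * ((real n - real k) * (real n + 1 - real k) * c)"
    using binomial_lower [of "n - 1" k] assms 2 by (simp add: of_nat_diff algebra_simps)
  then show "real (n - 1 choose k) = (real n - real k) * (real n + 1 - real k) * c" using pos by simp
  have "(real n * (real n + 1)) * ((real k + 1) * c') = (real n * (real n + 1)) * ((real n + 1 - real k) * c)"
    using binomial_step [of k "n + 1"] unfolding 1 by (simp add: algebra_simps)
  then show "(real k + 1) * c' = (real n + 1 - real k) * c" using pos by simp
qed

lemma binomial_rising_reduced:
  fixes n k :: nat
  assumes "n > 0"
  obtains e e' :: real where "real (n + 1 + k choose k) = (real n + real k) * (real n + real k + 1) * e"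
    "real (n + k choose k) = (real n + 1) * (real n + real k) * e"
    "real (n - 1 + k choose k) = real n * (real n + 1) * e"
    "real (n - 1 + (k + 1) choose (k + 1)) = real n * (real n + 1) * e'"
    "(real k + 1) * e' = (real n + real k) * e"
proof
  define e where "e = real (n - 1 + k choose k) / (real n * (real n + 1))"
  define e' where "e' = real (n - 1 + (k + 1) choose (k + 1)) / (real n * (real n + 1))"
  have pos: "real n > 0" using assms by simp
  show 1: "real (n - 1 + k choose k) = real n * (real n + 1) * e"
    "real (n - 1 + (k + 1) choose (k + 1)) = real n * (real n + 1) * e'"
    using pos by (simp_all add: e_def e'_def)
  have "real n * real (n + k choose k) = real n * ((real n + 1) * (real n + real k) * e)"
    using binomial_lower [of "n - 1 + k" k] assms unfolding 1 by (simp add: of_nat_diff algebra_simps)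
  then show 2: "real (n + k choose k) = (real n + 1) * (real n + real k) * e" using pos by simp
  have "(real n + 1) * real (n + 1 + k choose k) = (real n + 1) * ((real n + real k) * (real n + real k + 1) * e)"
    using binomial_lower [of "n + k" k] unfolding 2 by (simp add: algebra_simps)
  then show "real (n + 1 + k choose k) = (real n + real k) * (real n + real k + 1) * e" using pos by simp
  have "(k + 1) * (n - 1 + (k + 1) choose (k + 1)) = (n + k) * (n - 1 + k choose k)"
    using Suc_times_binomial_eq [of "n - 1 + k" k] assms by simp
  from arg_cong [OF this, of real]
  have "(real n * (real n + 1)) * ((real k + 1) * e') = (real n * (real n + 1)) * ((real n + real k) * e)"
    unfolding of_nat_mult 1 by (simp add: algebra_simps)
  then show "(real k + 1) * e' = (real n + real k) * e" using pos by simp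
qed

lemma binomial_double_reduced:
  fixes n k :: nat
  assumes "n > 0"
  obtains d d' :: real where "real (2 * k choose (n - 1)) = real n * (real n + 1) * d"
    "real (2 * k choose n) = (2 * real k - real n + 1) * (real n + 1) * d"
    "real (2 * k choose (n + 1)) = (2 * real k - real n + 1) * (2 * real k - real n) * d"
    "real (2 * (k + 1) choose (n - 1)) = real n * (real n + 1) * d'"
    "(2 * real k + 3 - real n) * (2 * real k + 2 - real n) * d' = (2 * real k + 2) * (2 * real k + 1) * d"
proof
  define d where "d = real (2 * k choose (n - 1)) / (real n * (real n + 1))"
  define d' where "d' = real (2 * (k + 1) choose (n - 1)) / (real n * (real n + 1))"
  have pos: "real n > 0" using assms by simp
  show 1: "real (2 * k choose (n - 1)) = real n * (real n + 1) * d"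
    "real (2 * (k + 1) choose (n - 1)) = real n * (real n + 1) * d'"
    using pos by (simp_all add: d_def d'_def)
  have "real n * real (2 * k choose n) = real n * ((2 * real k - real n + 1) * (real n + 1) * d)"
    using binomial_step [of "n - 1" "2 * k"] assms unfolding 1 by (simp add: of_nat_diff algebra_simps)
  then show 2: "real (2 * k choose n) = (2 * real k - real n + 1) * (real n + 1) * d" using pos by simp
  have "(real n + 1) * real (2 * k choose (n + 1)) = (real n + 1) * ((2 * real k - real n + 1) * (2 * real k - real n) * d)"
    using binomial_step [of n "2 * k"] unfolding 2 by (simp add: algebra_simps)
  then show "real (2 * k choose (n + 1)) = (2 * real k - real n + 1) * (2 * real k - real n) * d" using pos by simp
  have a: "(2 * real k + 1) * real (2 * k choose (n - 1)) = (2 * real k + 2 - real n) * real (2 * k + 1 choose (n - 1))"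
    using binomial_lower [of "2 * k" "n - 1"] assms by (simp add: of_nat_diff algebra_simps)
  have b: "(2 * real k + 2) * real (2 * k + 1 choose (n - 1)) = (2 * real k + 3 - real n) * real (2 * (k + 1) choose (n - 1))"
    using binomial_lower [of "2 * k + 1" "n - 1"] assms by (simp add: of_nat_diff algebra_simps del: binomial_Suc_Suc)
  have "(real n * (real n + 1)) * ((2 * real k + 3 - real n) * (2 * real k + 2 - real n) * d')
     = (real n * (real n + 1)) * ((2 * real k + 2) * (2 * real k + 1) * d)"
    using a b unfolding 1 by algebra
  then show "(2 * real k + 3 - real n) * (2 * real k + 2 - real n) * d' = (2 * real k + 2) * (2 * real k + 1) * d"
    using pos by simp
qed

text \<open>These closed forms produce the sequences D, \<open>s_10\<close> and \<open>s_7\<close>.\<close>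

definition sum_D :: "nat \<Rightarrow> int" where
  "sum_D n = int (\<Sum>k\<le>n. (n choose k)^2 * (n + k choose k))"

definition sum_s10 :: "nat \<Rightarrow> int" where
  "sum_s10 n = int (\<Sum>k\<le>n. (n choose k)^4)"

definition sum_s7 :: "nat \<Rightarrow> int" where
  "sum_s7 n = int (\<Sum>k\<le>n. (n choose k)^2 * (n + k choose k) * (2 * k choose n))"

lemma second_kind_D: "second_kind_rec 11 (- 1) 3 sum_D"
proof -
  have step: "(int n + 1)^2 * sum_D (n + 1) + - (11 * int n ^ 2 + 11 * int n + 3) * sum_D n + (- (int n ^ 2)) * sum_D (n - 1) = 0"
    if n: "n > 0" for n
  proof -
    define x where "x = real n"
    have x: "x * (x + 1) \<noteq> 0" using n by (simp add: x_def)
    define G where "G k = x^2 * (x + 1) * real k^3 * ((real k - 1)^2 + 3*(2*x + 1)*(real k - 1) - 11*x^2 - 9*x - 2)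
       * (real (n + 1 choose k) / (x * (x + 1)))^2 * (real (n - 1 + k choose k) / (x * (x + 1)))" for k
    show ?thesis
      unfolding sum_D_def
    proof (rule creative_telescoping [where G = G])
      fix k
      define y where "y = real k"
      obtain c c' where c: "real (n + 1 choose k) = x * (x + 1) * c"
        "real (n choose k) = x * (x + 1 - y) * c" "real (n - 1 choose k) = (x - y) * (x + 1 - y) * c"
        "real (n + 1 choose (k + 1)) = x * (x + 1) * c'" "(y + 1) * c' = (x + 1 - y) * c"
        using binomial_reduced [OF n] unfolding x_def y_def by blast
      obtain e e' where e: "real (n + 1 + k choose k) = (x + y) * (x + y + 1) * e"
        "real (n + k choose k) = (x + 1) * (x + y) * e" "real (n - 1 + k choose k) = x * (x + 1) * e"
        "real (n - 1 + (k + 1) choose (k + 1)) = x * (x + 1) * e'" "(y + 1) * e' = (x + y) * e"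
        using binomial_rising_reduced [OF n] unfolding x_def y_def by blast
      have G0: "G k = x^2 * (x + 1) * y^3 * ((y - 1)^2 + 3*(2*x + 1)*(y - 1) - 11*x^2 - 9*x - 2) * c^2 * e"
        unfolding G_def c e using x by (simp add: y_def)
      have "G (k + 1) = x^2 * (x + 1) * (y + 1)^3 * (((y + 1) - 1)^2 + 3*(2*x + 1)*((y + 1) - 1) - 11*x^2 - 9*x - 2) * c'^2 * e'"
        unfolding G_def c e using x by (simp add: y_def add.commute)
      also have "\<dots> = x^2 * (x + 1) * ((y + 1) * c')^2 * ((y + 1) * e') * (y^2 + 3*(2*x + 1)*y - 11*x^2 - 9*x - 2)"
        by algebra
      also have "\<dots> = x^2 * (x + 1) * ((x + 1 - y) * c)^2 * ((x + y) * e) * (y^2 + 3*(2*x + 1)*y - 11*x^2 - 9*x - 2)"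
        by (simp only: c(5) e(5))
      finally have G1: "G (k + 1) = x^2 * (x + 1) * ((x + 1 - y) * c)^2 * ((x + y) * e) * (y^2 + 3*(2*x + 1)*y - 11*x^2 - 9*x - 2)" .
      show "real_of_int ((int n + 1)^2) * real ((n + 1 choose k)^2 * (n + 1 + k choose k))
        + real_of_int (- (11 * int n ^ 2 + 11 * int n + 3)) * real ((n choose k)^2 * (n + k choose k))
        + real_of_int (- (int n ^ 2)) * real ((n - 1 choose k)^2 * (n - 1 + k choose k)) = G (k + 1) - G k"
        unfolding G0 G1 of_nat_mult of_nat_power c e
        by (simp add: x_def [symmetric]) algebra
    qed (simp_all add: binomial_eq_0 G_def)
  qed
  show ?thesis
    unfolding second_kind_rec_def
  proof (intro conjI allI)
    fix n show "(int n + 1)^2 * sum_D (n + 1) - (11 * int n ^ 2 + 11 * int n + 3) * sum_D n + (- 1) * int n ^ 2 * (if n = 0 then 0 else sum_D (n - 1)) = 0"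
      using step [of n] by (cases "n = 0") (simp_all add: sum_D_def algebra_simps)
  qed (simp add: sum_D_def)
qed

lemma first_kind_s10: "first_kind_rec 6 2 (- 64) 4 sum_s10"
proof -
  have step: "(int n + 1)^3 * sum_s10 (n + 1) + - ((2 * int n + 1) * (6 * int n ^ 2 + 6 * int n + 2)) * sum_s10 n + (int n * ((- 64) * int n ^ 2 + 4)) * sum_s10 (n - 1) = 0"
    if n: "n > 0" for n
  proof -
    define x where "x = real n"
    have x: "x * (x + 1) \<noteq> 0" using n by (simp add: x_def)
    define G where "G k = x * real k^4 * (- (10*x + 80*x^2 + 255*x^3 + 385*x^4 + 275*x^5 + 75*x^6) + (4 + 72*x + 368*x^2 + 796*x^3 + 756*x^4 + 260*x^5) * real k - (16 + 172*x + 600*x^2 + 818*x^3 + 374*x^4) * real k^2 + (24 + 184*x + 416*x^2 + 276*x^3) * real k^3 - (16 + 90*x + 104*x^2) * real k^4 + (4 + 16*x) * real k^5)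
       * (real (n + 1 choose k) / (x * (x + 1)))^4" for k
    show ?thesis
      unfolding sum_s10_def
    proof (rule creative_telescoping [where G = G])
      fix k
      define y where "y = real k"
      obtain c c' where c: "real (n + 1 choose k) = x * (x + 1) * c"
        "real (n choose k) = x * (x + 1 - y) * c" "real (n - 1 choose k) = (x - y) * (x + 1 - y) * c"
        "real (n + 1 choose (k + 1)) = x * (x + 1) * c'" "(y + 1) * c' = (x + 1 - y) * c"
        using binomial_reduced [OF n] unfolding x_def y_def by blast
      have G0: "G k = x * y^4 * (- (10*x + 80*x^2 + 255*x^3 + 385*x^4 + 275*x^5 + 75*x^6) + (4 + 72*x + 368*x^2 + 796*x^3 + 756*x^4 + 260*x^5) * y - (16 + 172*x + 600*x^2 + 818*x^3 + 374*x^4) * y^2 + (24 + 184*x + 416*x^2 + 276*x^3) * y^3 - (16 + 90*x + 104*x^2) * y^4 + (4 + 16*x) * y^5) * c^4"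
        unfolding G_def c using x by (simp add: y_def)
      have "G (k + 1) = x * (y + 1)^4 * (- (10*x + 80*x^2 + 255*x^3 + 385*x^4 + 275*x^5 + 75*x^6) + (4 + 72*x + 368*x^2 + 796*x^3 + 756*x^4 + 260*x^5) * (y + 1) - (16 + 172*x + 600*x^2 + 818*x^3 + 374*x^4) * (y + 1)^2 + (24 + 184*x + 416*x^2 + 276*x^3) * (y + 1)^3 - (16 + 90*x + 104*x^2) * (y + 1)^4 + (4 + 16*x) * (y + 1)^5) * c'^4"
        unfolding G_def c using x by (simp add: y_def add.commute)
      also have "\<dots> = x * ((y + 1) * c')^4 * (- (10*x + 80*x^2 + 255*x^3 + 385*x^4 + 275*x^5 + 75*x^6) + (4 + 72*x + 368*x^2 + 796*x^3 + 756*x^4 + 260*x^5) * (y + 1) - (16 + 172*x + 600*x^2 + 818*x^3 + 374*x^4) * (y + 1)^2 + (24 + 184*x + 416*x^2 + 276*x^3) * (y + 1)^3 - (16 + 90*x + 104*x^2) * (y + 1)^4 + (4 + 16*x) * (y + 1)^5)"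
        by algebra
      also have "\<dots> = x * ((x + 1 - y) * c)^4 * (- (10*x + 80*x^2 + 255*x^3 + 385*x^4 + 275*x^5 + 75*x^6) + (4 + 72*x + 368*x^2 + 796*x^3 + 756*x^4 + 260*x^5) * (y + 1) - (16 + 172*x + 600*x^2 + 818*x^3 + 374*x^4) * (y + 1)^2 + (24 + 184*x + 416*x^2 + 276*x^3) * (y + 1)^3 - (16 + 90*x + 104*x^2) * (y + 1)^4 + (4 + 16*x) * (y + 1)^5)"
        by (simp only: c(5))
      finally have G1: "G (k + 1) = x * ((x + 1 - y) * c)^4 * (- (10*x + 80*x^2 + 255*x^3 + 385*x^4 + 275*x^5 + 75*x^6) + (4 + 72*x + 368*x^2 + 796*x^3 + 756*x^4 + 260*x^5) * (y + 1) - (16 + 172*x + 600*x^2 + 818*x^3 + 374*x^4) * (y + 1)^2 + (24 + 184*x + 416*x^2 + 276*x^3) * (y + 1)^3 - (16 + 90*x + 104*x^2) * (y + 1)^4 + (4 + 16*x) * (y + 1)^5)" .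
      show "real_of_int ((int n + 1)^3) * real ((n + 1 choose k)^4)
        + real_of_int (- ((2 * int n + 1) * (6 * int n ^ 2 + 6 * int n + 2))) * real ((n choose k)^4)
        + real_of_int (int n * ((- 64) * int n ^ 2 + 4)) * real ((n - 1 choose k)^4) = G (k + 1) - G k"
        unfolding G0 G1 of_nat_mult of_nat_power c
        by (simp add: x_def [symmetric]) algebra
    qed (simp_all add: binomial_eq_0 G_def)
  qed
  show ?thesis
    unfolding first_kind_rec_def
  proof (intro conjI allI)
    fix n show "(int n + 1)^3 * sum_s10 (n + 1) - (2 * int n + 1) * (6 * int n ^ 2 + 6 * int n + 2) * sum_s10 n + int n * ((- 64) * int n ^ 2 + 4) * (if n = 0 then 0 else sum_s10 (n - 1)) = 0"
      using step [of n] by (cases "n = 0") (simp_all add: sum_s10_def algebra_simps)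
  qed (simp add: sum_s10_def)
qed

lemma first_kind_s7: "first_kind_rec 13 4 (- 27) 3 sum_s7"
proof -
  have step: "(int n + 1)^3 * sum_s7 (n + 1) + - ((2 * int n + 1) * (13 * int n ^ 2 + 13 * int n + 4)) * sum_s7 n + (int n * ((- 27) * int n ^ 2 + 3)) * sum_s7 (n - 1) = 0"
    if n: "n > 0" for n
  proof -
    define x where "x = real n"
    have x: "x * (x + 1) \<noteq> 0" using n by (simp add: x_def)
    define G where "G k = x^2 * (x + 1)^2 * real k^2 * (2 * real k - x + 1) * (2 * real k - x) * ((4 + 15*x + 18*x^2 + 7*x^3) - (13 + 39*x + 26*x^2) * real k + (7 + 15*x) * real k^2)
       * (real (n + 1 choose k) / (x * (x + 1)))^2 * (real (n - 1 + k choose k) / (x * (x + 1))) * (real (2 * k choose (n - 1)) / (x * (x + 1)))" for k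
    show ?thesis
      unfolding sum_s7_def
    proof (rule creative_telescoping [where G = G])
      fix k
      define y where "y = real k"
      obtain c c' where c: "real (n + 1 choose k) = x * (x + 1) * c"
        "real (n choose k) = x * (x + 1 - y) * c" "real (n - 1 choose k) = (x - y) * (x + 1 - y) * c"
        "real (n + 1 choose (k + 1)) = x * (x + 1) * c'" "(y + 1) * c' = (x + 1 - y) * c"
        using binomial_reduced [OF n] unfolding x_def y_def by blast
      obtain e e' where e: "real (n + 1 + k choose k) = (x + y) * (x + y + 1) * e"
        "real (n + k choose k) = (x + 1) * (x + y) * e" "real (n - 1 + k choose k) = x * (x + 1) * e"
        "real (n - 1 + (k + 1) choose (k + 1)) = x * (x + 1) * e'" "(y + 1) * e' = (x + y) * e"
        using binomial_rising_reduced [OF n] unfolding x_def y_def by blast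
      obtain d d' where d: "real (2 * k choose (n - 1)) = x * (x + 1) * d"
        "real (2 * k choose n) = (2 * y - x + 1) * (x + 1) * d"
        "real (2 * k choose (n + 1)) = (2 * y - x + 1) * (2 * y - x) * d"
        "real (2 * (k + 1) choose (n - 1)) = x * (x + 1) * d'"
        "(2 * y + 3 - x) * (2 * y + 2 - x) * d' = (2 * y + 2) * (2 * y + 1) * d"
        using binomial_double_reduced [OF n] unfolding x_def y_def by blast
      have G0: "G k = x^2 * (x + 1)^2 * y^2 * (2 * y - x + 1) * (2 * y - x) * ((4 + 15*x + 18*x^2 + 7*x^3) - (13 + 39*x + 26*x^2) * y + (7 + 15*x) * y^2) * c^2 * e * d"
        unfolding G_def c e d using x by (simp add: y_def)
      have "G (k + 1) = x^2 * (x + 1)^2 * (y + 1)^2 * (2 * (y + 1) - x + 1) * (2 * (y + 1) - x) * ((4 + 15*x + 18*x^2 + 7*x^3) - (13 + 39*x + 26*x^2) * (y + 1) + (7 + 15*x) * (y + 1)^2) * c'^2 * e' * d'"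
        unfolding G_def c e d using x by (simp add: y_def add.commute)
      also have "\<dots> = x^2 * (x + 1)^2 * ((y + 1) * c')^2 * e' * ((2 * y + 3 - x) * (2 * y + 2 - x) * d') * ((4 + 15*x + 18*x^2 + 7*x^3) - (13 + 39*x + 26*x^2) * (y + 1) + (7 + 15*x) * (y + 1)^2)"
        by algebra
      also have "\<dots> = x^2 * (x + 1)^2 * ((x + 1 - y) * c)^2 * (2 * ((x + y) * e)) * (2 * y + 1) * d * ((4 + 15*x + 18*x^2 + 7*x^3) - (13 + 39*x + 26*x^2) * (y + 1) + (7 + 15*x) * (y + 1)^2)"
        unfolding c(5) d(5) e(5) [symmetric] by algebra
      finally have G1: "G (k + 1) = x^2 * (x + 1)^2 * ((x + 1 - y) * c)^2 * (2 * ((x + y) * e)) * (2 * y + 1) * d * ((4 + 15*x + 18*x^2 + 7*x^3) - (13 + 39*x + 26*x^2) * (y + 1) + (7 + 15*x) * (y + 1)^2)" .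
      show "real_of_int ((int n + 1)^3) * real ((n + 1 choose k)^2 * (n + 1 + k choose k) * (2 * k choose (n + 1)))
        + real_of_int (- ((2 * int n + 1) * (13 * int n ^ 2 + 13 * int n + 4))) * real ((n choose k)^2 * (n + k choose k) * (2 * k choose (n)))
        + real_of_int (int n * ((- 27) * int n ^ 2 + 3)) * real ((n - 1 choose k)^2 * (n - 1 + k choose k) * (2 * k choose (n - 1))) = G (k + 1) - G k"
        unfolding G0 G1 of_nat_mult of_nat_power c e d
        by (simp add: x_def [symmetric]) algebra
    qed (simp_all add: binomial_eq_0 G_def)
  qed
  show ?thesis
    unfolding first_kind_rec_def
  proof (intro conjI allI)
    fix n show "(int n + 1)^3 * sum_s7 (n + 1) - (2 * int n + 1) * (13 * int n ^ 2 + 13 * int n + 4) * sum_s7 n + int n * ((- 27) * int n ^ 2 + 3) * (if n = 0 then 0 else sum_s7 (n - 1)) = 0"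
      using step [of n] by (cases "n = 0") (simp_all add: sum_s7_def algebra_simps)
  qed (simp add: sum_s7_def)
qed

section \<open>Congruences for the binomial sums\<close>

lemma choose_prime_shift:
  assumes "prime (p::nat)"
  shows "[N + p choose K = (N choose K) + (if p \<le> K then N choose (K - p) else 0)] (mod p)"
proof -
  have "N + p choose K = (\<Sum>l\<le>K. (p choose l) * (N choose (K - l)))"
    by (simp add: vandermonde add.commute)
  also have "[\<dots> = (\<Sum>l\<le>K. if l = 0 then N choose K else if l = p then N choose (K - p) else 0)] (mod p)"
  proof (rule cong_sum)
    fix l assume "l \<in> {..K}"
    show "[(p choose l) * (N choose (K - l)) =
        (if l = 0 then N choose K else if l = p then N choose (K - p) else 0)] (mod p)"
    proof (cases "0 < l \<and> l < p")
      case True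
      then show ?thesis using dvd_choose_prime [of l p] assms by (auto simp: cong_0_iff)
    qed (use assms in \<open>auto simp: binomial_eq_0\<close>)
  qed
  also have "(\<Sum>l\<le>K. if l = 0 then N choose K else if l = p then N choose (K - p) else 0)
      = (\<Sum>l\<le>K. if l = 0 then N choose K else 0) + (\<Sum>l\<le>K. if l = p then N choose (K - p) else 0)"
    using assms unfolding sum.distrib [symmetric] by (intro sum.cong) auto
  also have "\<dots> = (N choose K) + (if p \<le> K then N choose (K - p) else 0)"
    by simp
  finally show ?thesis .
qed

lemma lucas:
  assumes "prime (p::nat)" "i < p" "j < p"
  shows "[p * n + i choose (p * k + j) = (n choose k) * (i choose j)] (mod p)"
proof (induction n arbitrary: k)
  case 0
  show ?case
  proof (cases k)
    case (Suc k')
    then have "i < p * k + j" using assms by simp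
    then show ?thesis using Suc by (simp add: binomial_eq_0)
  qed simp
next
  case (Suc n)
  have "[p * n + i + p choose (p * k + j) = (p * n + i choose (p * k + j))
      + (if p \<le> p * k + j then p * n + i choose (p * k + j - p) else 0)] (mod p)"
    by (rule choose_prime_shift [OF assms(1)])
  moreover have "[(p * n + i choose (p * k + j))
      + (if p \<le> p * k + j then p * n + i choose (p * k + j - p) else 0) = (Suc n choose k) * (i choose j)] (mod p)"
  proof (cases k)
    case 0
    then show ?thesis using assms Suc.IH [of 0] by simp
  next
    case (Suc k')
    have e: "p * k + j - p = p * k' + j" using Suc by simp
    have "[(p * n + i choose (p * k + j)) + (p * n + i choose (p * k' + j))
        = (n choose k) * (i choose j) + (n choose k') * (i choose j)] (mod p)"
      by (intro cong_add Suc.IH)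
    then show ?thesis unfolding e using Suc by (simp add: algebra_simps)
  qed
  ultimately show ?case by (metis cong_trans mult_Suc_right add.commute add.left_commute)
qed

definition term_D :: "nat \<Rightarrow> nat \<Rightarrow> nat" where
  "term_D n k = (n choose k)^2 * (n + k choose k)"

text \<open>When the digits \<open>i\<close> and \<open>j\<close> produce a carry in \<open>n + k\<close>, both sides vanish: the last digit of the sum is then smaller
than \<open>j\<close>.\<close>

lemma term_D_lucas:
  assumes p: "prime (p::nat)" "i < p" "j < p"
  shows "[term_D (p * n + i) (p * k + j) = term_D n k * term_D i j] (mod p)"
proof -
  let ?x = "(n choose k) * (i choose j)"
  have "[(i choose j) * (p * n + i + (p * k + j) choose (p * k + j))
     = (i choose j) * ((n + k choose k) * (i + j choose j))] (mod p)"
  proof (cases "i + j < p")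
    case True
    have "p * n + i + (p * k + j) = p * (n + k) + (i + j)" by (simp add: algebra_simps)
    then show ?thesis using lucas [OF p(1) True p(3), of "n + k" k]
      by (intro cong_mult cong_refl) (simp only:)
  next
    case False
    then have small: "i + j - p < p" "i + j - p < j" using p by auto
    have e: "p * n + i + (p * k + j) = p * (n + k + 1) + (i + j - p)" "i + j = p * 1 + (i + j - p)"
      using False by (simp_all add: algebra_simps)
    have "[p * n + i + (p * k + j) choose (p * k + j) = 0] (mod p)" "[i + j choose j = 0] (mod p)"
      using lucas [OF p(1) small(1) p(3), of "n + k + 1" k] lucas [OF p(1) small(1) p(3), of 1 0] small(2)
      unfolding e(1) e(2) [symmetric] by (simp_all add: binomial_eq_0)
    then show ?thesis unfolding cong_0_iff by (simp add: cong_def dvd_imp_mod_0 dvd_mult)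
  qed
  then have "[?x * (n choose k) * ((i choose j) * (p * n + i + (p * k + j) choose (p * k + j)))
     = ?x * (n choose k) * ((i choose j) * ((n + k choose k) * (i + j choose j)))] (mod p)"
    by (rule cong_scalar_left)
  moreover have "[term_D (p * n + i) (p * k + j) = ?x^2 * (p * n + i + (p * k + j) choose (p * k + j))] (mod p)"
    unfolding term_D_def by (intro cong_mult cong_pow lucas p cong_refl)
  ultimately show ?thesis
    unfolding term_D_def by (auto simp: power2_eq_square mult_ac elim: cong_trans)
qed

lemma sum_D_eq: "n < N \<Longrightarrow> sum_D n = int (\<Sum>k<N. term_D n k)"
  unfolding sum_D_def term_D_def by (intro arg_cong [of _ _ int] sum.mono_neutral_left) auto

lemma sum_D_lucas:
  assumes p: "prime (p::nat)" "i < p"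
  shows "[sum_D (p * n + i) = sum_D n * sum_D i] (mod int p)"
proof -
  have "p * n + i < (n + 1) * p" using p by (simp add: algebra_simps)
  then have "sum_D (p * n + i) = int (\<Sum>K<(n + 1) * p. term_D (p * n + i) K)" by (rule sum_D_eq)
  also have "(\<Sum>K<(n + 1) * p. term_D (p * n + i) K)
      = (\<Sum>k<n+1. \<Sum>j<p. term_D (p * n + i) (p * k + j))"
    unfolding sum.nat_group [symmetric]
  proof (rule sum.cong [OF refl])
    fix k show "sum (term_D (p * n + i)) {k * p..<k * p + p} = (\<Sum>j<p. term_D (p * n + i) (p * k + j))"
      using sum.shift_bounds_nat_ivl [of "term_D (p * n + i)" 0 "k * p" p]
      by (simp add: atLeast0LessThan ac_simps)
  qed
  also have "[int \<dots> = int (\<Sum>k<n+1. \<Sum>j<p. term_D n k * term_D i j)] (mod int p)"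
    unfolding cong_int_iff using p by (intro cong_sum term_D_lucas) auto
  also have "int (\<Sum>k<n+1. \<Sum>j<p. term_D n k * term_D i j) = sum_D n * sum_D i"
    using sum_D_eq [of n "n + 1"] sum_D_eq [OF p(2)] by (simp add: sum_product del: sum.lessThan_Suc)
  finally show ?thesis .
qed

text \<open>By the multiplicativity over base 5 digits and \<open>3^5 = 3\<close> modulo 5, it suffices to look at \<open>n < 5\<close>.\<close>

lemma sum_D_cong_5: "[sum_D n = 3 ^ n] (mod 5)"
proof (induction n rule: less_induct)
  case (less n)
  define m i where "m = n div 5" and "i = n mod 5"
  have n: "n = 5 * m + i" and i: "i < 5" by (simp_all add: m_def i_def)
  have small: "[sum_D i = 3 ^ i] (mod 5)"
  proof -
    consider "i = 0" | "i = 1" | "i = 2" | "i = 3" | "i = 4" using i by linarith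
    then show ?thesis by cases (simp_all add: sum_D_def cong_def eval_nat_numeral)
  qed
  show ?case
  proof (cases "m = 0")
    case False
    have "[sum_D n = sum_D m * sum_D i] (mod int 5)"
      unfolding n by (rule sum_D_lucas) (use i in simp_all)
    also have "[sum_D m * sum_D i = 3 ^ m * 3 ^ i] (mod int 5)"
      using less.IH [of m] small False n by (intro cong_mult) simp_all
    also have "[3 ^ m * 3 ^ i = (3 ^ 5) ^ m * 3 ^ i] (mod int 5)"
      by (intro cong_mult cong_pow) (simp_all add: cong_def)
    also have "(3 ^ 5) ^ m * 3 ^ i = (3 :: int) ^ n" by (simp only: n power_add power_mult)
    finally show ?thesis by simp
  qed (use n small in simp)
qed

lemma choose_symmetric_product:
  "k \<le> n \<Longrightarrow> (n choose k) * (n + k choose k) = (n + k choose (2 * k)) * (2 * k choose k)"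
  using choose_mult [of k "2 * k" "n + k"] by (simp add: mult.commute)

text \<open>For positive \<open>k\<close> the summand contains the even factor \<open>2 * k choose k\<close>.\<close>

lemma sum_D_odd: "odd (sum_D n)"
proof -
  have "even (term_D n k)" if "0 < k" "k \<le> n" for k
  proof -
    have "term_D n k = (n choose k) * ((n + k choose (2 * k)) * (2 * k choose k))"
      using choose_symmetric_product [OF that(2)] by (simp add: term_D_def power2_eq_square)
    then show ?thesis using that by (simp add: choose_multiple)
  qed
  then have "even (\<Sum>k\<in>{..n} - {0}. term_D n k)" by (intro dvd_sum) auto
  moreover have "(\<Sum>k\<le>n. term_D n k) = 1 + (\<Sum>k\<in>{..n} - {0}. term_D n k)"
    by (subst sum.remove [of _ 0]) (auto simp: term_D_def)
  ultimately have "odd (int (\<Sum>k\<le>n. term_D n k))" by (simp only: even_of_nat) simp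
  then show ?thesis unfolding sum_D_def term_D_def .
qed

lemma sum_D_cong: "[sum_D n = 3 ^ n] (mod 10)"
proof -
  have "5 dvd sum_D n - 3 ^ n" using sum_D_cong_5 by (simp add: cong_iff_dvd_diff)
  moreover have "2 dvd sum_D n - 3 ^ n" using sum_D_odd by simp
  ultimately have "10 dvd sum_D n - 3 ^ n" by presburger
  then show ?thesis by (simp add: cong_iff_dvd_diff)
qed

text \<open>Modulo 2 fourth powers can be dropped, and the sum becomes the row sum \<open>2^n\<close> of Pascal's triangle.\<close>

lemma sum_s10_cong: "[sum_s10 n = 2 ^ n] (mod 2)"
proof -
  have "[(\<Sum>k\<le>n. (n choose k) ^ 4) = (\<Sum>k\<le>n. n choose k)] (mod 2)"
    by (intro cong_sum) (simp add: cong_def mod_2_eq_odd)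
  then have "[int (\<Sum>k\<le>n. (n choose k) ^ 4) = int (2 ^ n)] (mod int 2)"
    unfolding cong_int_iff choose_row_sum .
  then show ?thesis by (simp add: sum_s10_def)
qed

text \<open>The summand of \<open>s_7\<close> is \<open>(2 * k choose k)^2 * (n + k choose 2 * k) * (k choose (n - k))\<close>, and for \<open>k > 0\<close>
the number \<open>2 * k choose k\<close> is twice the first factor here. Hence modulo 8 it is \<open>4\<close> times this term.\<close>

definition term_s7 :: "nat \<Rightarrow> nat \<Rightarrow> nat" where
  "term_s7 n k = (2 * k - 1 choose (k - 1)) * (n + k choose (2 * k)) * (k choose (n - k))"

lemma even_sum_even_indices:
  fixes f :: "nat \<Rightarrow> nat" and j :: nat
  assumes "\<And>m. m < j \<Longrightarrow> even (f (2 * m + 1))"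
  shows "even (\<Sum>k\<le>2 * j. f k) \<longleftrightarrow> even (\<Sum>m\<le>j. f (2 * m))"
  using assms by (induction j) auto

lemma central_even: "0 < k \<Longrightarrow> even (2 * k choose k)"
  by (simp add: choose_multiple)

lemma lucas_2:
  assumes "i < 2" "j < 2"
  shows "even (2 * n + i choose (2 * k + j)) \<longleftrightarrow> even ((n choose k) * (i choose j))"
  using lucas [OF two_is_prime_nat assms, of n k] by (metis cong_dvd_iff dvd_refl)

lemma even_term_s7_odd:
  assumes "k \<ge> 1" shows "even (term_s7 n (2 * k + 1))"
proof -
  have "even (2 * (2 * k) + 1 choose (2 * k + 0))"
    using lucas_2 [of 1 0 "2 * k" k] central_even [of k] assms by simp
  then show ?thesis by (simp add: term_s7_def)
qed

text \<open>The term for \<open>k = 1\<close> vanishes when \<open>n > 2\<close>. By Lucas modulo 2,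
a term with odd \<open>k > 1\<close> is even, and for odd \<open>n\<close> so is a term with even \<open>k\<close>, and 
halving both \<open>n\<close> and \<open>k\<close>
preserves parity. This reduces the claim to \<open>n = 2\<close>, where the terms 3 and 3 for \<open>k = 1\<close> and \<open>k = 2\<close> add up to an even number.\<close>

lemma sum_term_s7_even: "n \<ge> 2 \<Longrightarrow> even (\<Sum>k\<le>n. term_s7 n k)"
proof (induction n rule: less_induct)
  case (less n)
  have zero: "term_s7 m 0 = 0" if "m > 0" for m using that by (simp add: term_s7_def binomial_eq_0)
  have one: "term_s7 m 1 = 0" if "m > 2" for m using that by (simp add: term_s7_def binomial_eq_0)
  consider j where "n = 2 * j + 1" "j \<ge> 1" | "n = 2" | j where "n = 2 * j" "j \<ge> 2"
    using less.prems by (cases "even n") (auto elim!: evenE oddE, force)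
  then show ?case
  proof cases
    case 1
    have "even (term_s7 n k)" if "k \<le> n" for k
    proof (cases "even k")
      case True
      then obtain m where m: "k = 2 * m" by (elim evenE)
      then have "n - k = 2 * (j - m) + 1" using that 1 by simp
      then have "even (k choose (n - k))"
        using lucas_2 [of 0 1 m "j - m"] by (simp add: m)
      then show ?thesis by (simp add: term_s7_def)
    next
      case False
      then obtain m where m: "k = 2 * m + 1" by (elim oddE)
      show ?thesis using even_term_s7_odd [of m n] one [of n] 1 by (cases "m = 0") (simp_all add: m)
    qed
    then show ?thesis by (intro dvd_sum) auto
  next
    case 2
    have "(\<Sum>k\<le>2. term_s7 2 k) = 6" by (simp add: term_s7_def eval_nat_numeral)
    then show ?thesis using 2 by simp
  next
    case (3 j)
    have "even (term_s7 n (2 * m + 1))" for m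
      using even_term_s7_odd [of m n] one [of n] 3 by (cases "m = 0") simp_all
    then have "even (\<Sum>k\<le>n. term_s7 n k) \<longleftrightarrow> even (\<Sum>m\<le>j. term_s7 n (2 * m))"
      unfolding 3(1) by (intro even_sum_even_indices) auto
    also have "\<dots> \<longleftrightarrow> even (\<Sum>m\<le>j. term_s7 j m)"
    proof -
      have "even (term_s7 n (2 * m)) \<longleftrightarrow> even (term_s7 j m)" if "m \<le> j" for m
      proof (cases "m = 0")
        case True then show ?thesis using zero [of n] zero [of j] 3 by simp
      next
        case False
        have a: "2 * (2 * m) - 1 = 2 * (2 * m - 1) + 1" "2 * m - 1 = 2 * (m - 1) + 1" using False by auto
        have "even (2 * (2 * m) - 1 choose (2 * m - 1)) \<longleftrightarrow> even (2 * m - 1 choose (m - 1))"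
          using lucas_2 [of 1 1 "2 * m - 1" "m - 1"] unfolding a [symmetric] by simp
        moreover have "even (n + 2 * m choose (2 * (2 * m))) \<longleftrightarrow> even (j + m choose (2 * m))"
          using lucas_2 [of 0 0 "j + m" "2 * m"] by (simp add: 3 algebra_simps)
        moreover have "even (2 * m choose (n - 2 * m)) \<longleftrightarrow> even (m choose (j - m))"
          using lucas_2 [of 0 0 m "j - m"] by (simp add: 3 right_diff_distrib')
        ultimately show ?thesis unfolding term_s7_def by simp
      qed
      then have "[(\<Sum>m\<le>j. term_s7 n (2 * m)) = (\<Sum>m\<le>j. term_s7 j m)] (mod 2)"
        by (intro cong_sum) (simp add: cong_def mod_2_eq_odd)
      then show ?thesis by (rule cong_dvd_iff [OF _ ]) 
    qed
    finally show ?thesis using less.IH [of j] 3 by simp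
  qed
qed

lemma sum_s7_cong: "[sum_s7 n = 4 ^ n] (mod 8)"
proof -
  consider "n = 0" | "n = 1" | "n \<ge> 2" by linarith
  then show ?thesis
  proof cases
    case 3
    have "[(n choose k)^2 * (n + k choose k) * (2 * k choose n) = 4 * term_s7 n k] (mod 8)" if "k \<le> n" for k
    proof (cases "k = 0")
      case False
      define c where "c = (2 * k - 1 choose (k - 1))"
      have c: "2 * k choose k = 2 * c" using False by (simp add: c_def choose_multiple)
      have "(2 * k choose n) * (n choose k) = (2 * k choose k) * (k choose (n - k))"
        using choose_mult [OF that, of "2 * k"] that by (cases "n \<le> 2 * k") (simp_all add: binomial_eq_0)
      then have "(n choose k)^2 * (n + k choose k) * (2 * k choose n)
          = 4 * (c^2 * (n + k choose (2 * k)) * (k choose (n - k)))"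
        using choose_symmetric_product [OF that] unfolding c power2_eq_square by algebra
      moreover have "[c^2 * (n + k choose (2 * k)) * (k choose (n - k)) = term_s7 n k] (mod 2)"
        unfolding term_s7_def c_def [symmetric] by (simp add: cong_def mod_2_eq_odd)
      then have "[4 * (c^2 * (n + k choose (2 * k)) * (k choose (n - k))) = 4 * term_s7 n k] (mod 4 * 2)"
        unfolding cong_def by (simp only: mod_mult_mult1)
      ultimately show ?thesis by simp
    qed (use 3 in \<open>simp add: term_s7_def binomial_eq_0\<close>)
    then have "[(\<Sum>k\<le>n. (n choose k)^2 * (n + k choose k) * (2 * k choose n))
        = (\<Sum>k\<le>n. 4 * term_s7 n k)] (mod 8)"
      by (intro cong_sum) auto
    moreover have "8 dvd (\<Sum>k\<le>n. 4 * term_s7 n k)"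
      using sum_term_s7_even [OF 3] by (auto simp flip: sum_distrib_left)
    ultimately have "8 dvd (\<Sum>k\<le>n. (n choose k)^2 * (n + k choose k) * (2 * k choose n))"
      using cong_dvd_iff by blast
    then have "int 8 dvd sum_s7 n" unfolding sum_s7_def int_dvd_int_iff .
    moreover have "(8::int) dvd 4 ^ n"
      using 3 by (auto simp: le_iff_add power_add)
    ultimately show ?thesis by (simp add: cong_def mod_eq_0_iff_dvd)
  qed (simp_all add: sum_s7_def)
qed

section \<open>From generating functions to congruences\<close>

lemma dvd_diff_geo_iff: "of_int N dvd f - geo a \<longleftrightarrow> (\<forall>n. [f $ n = a ^ n] (mod N))"
  by (simp add: of_int_fps_dvd_iff cong_iff_dvd_diff)

lemma compose_dvd:
  assumes "of_int N dvd H - K" and "r $ 0 = (0 :: int)"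
  shows "of_int N dvd (H oo r) - (K oo r)"
proof -
  obtain J where "H - K = of_int N * J" using assms(1) by (elim dvdE)
  then have "(H - K) oo r = (of_int N oo r) * (J oo r)"
    by (simp add: fps_compose_mult_distrib [OF assms(2)])
  then show ?thesis by (simp add: fps_compose_sub_distrib flip: fps_of_int)
qed

lemma second_kind_pullback_cong:
  assumes "second_kind_rec A B l u" "second_kind_rec A B l (fps_nth (geo l * (H oo r)))"
    and "of_int N dvd H - 1" "r $ 0 = 0"
  shows "[u n = l ^ n] (mod N)"
proof -
  have "geo l * (H oo r) - geo l = geo l * ((H oo r) - (1 oo r))" by (simp add: algebra_simps)
  then have "of_int N dvd geo l * (H oo r) - geo l" using compose_dvd [OF assms(3,4)] by simp
  then show ?thesis
    unfolding dvd_diff_geo_iff second_kind_rec_unique [OF assms(1,2)] by blast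
qed

text \<open>Put \<open>b = a - 2 l\<close> and let \<open>F\<close> be the generating function of \<open>v\<close>. By the symmetric square relation,
\<open>(1 - b X) F\<close> evaluated at \<open>w = - X / Q\<close> equals \<open>(Q + b X) f^2 = (1 - 2 l X + c X^2) f^2\<close>. If this is congruent to 1,
then so is \<open>(1 - b X) F\<close>, because the substitution of \<open>w\<close> reflects congruences.\<close>

lemma symmetric_square_cong:
  assumes u: "second_kind_rec a c l u" and v: "first_kind_rec a (a - 2 * l) (a^2 - 4 * c) 0 v"
    and N: "of_int N dvd Abs_fps u ^ 2 * (1 - 2 * of_int l * fps_X + of_int c * fps_X^2) - 1"
  shows "[v n = (a - 2 * l) ^ n] (mod N)"
proof -
  define f F where "f = Abs_fps u" and "F = Abs_fps v"
  define Q :: "int fps" where "Q = 1 - of_int a * fps_X + of_int c * fps_X^2"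
  have "Q = 1 - fps_X * (of_int a - of_int c * fps_X)" by (simp add: Q_def algebra_simps power2_eq_square)
  moreover have "(fps_X * (of_int a - of_int c * fps_X)) $ 0 = 0" by simp
  ultimately obtain q where q: "Q * q = 1" using inverse_exists by metis
  define w where "w = - (fps_X * q)"
  have w0: "w $ 0 = 0" by (simp add: w_def)
  have Fw: "F oo w = Q * f ^ 2"
    unfolding F_def f_def w_def by (rule symmetric_square [OF u v Q_def q])
  define b :: int where "b = a - 2 * l"
  have "((1 - of_int b * fps_X) * F - 1) oo w = (1 - of_int b * w) * (Q * f^2) - 1"
    using w0 Fw by (simp add: fps_compose_mult_distrib fps_compose_sub_distrib flip: fps_of_int)
  also have "\<dots> = f^2 * (Q + of_int b * fps_X * (Q * q)) - 1"
    by (simp add: w_def algebra_simps)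
  also have "Q * q = 1" by (rule q)
  also have "Q + of_int b * fps_X * 1 = 1 - 2 * of_int l * fps_X + of_int c * fps_X^2"
    by (simp add: Q_def b_def algebra_simps)
  finally have "of_int N dvd ((1 - of_int b * fps_X) * F - 1) oo w"
    using N unfolding f_def by (rule ssubst)
  moreover have "is_unit (w $ 1)"
  proof -
    have "q $ 0 = 1" using arg_cong [OF q, of "\<lambda>f. f $ 0"] by (simp add: Q_def power2_eq_square)
    then show ?thesis by (simp add: w_def)
  qed
  ultimately have "of_int N dvd (1 - of_int b * fps_X) * F - 1"
    by (rule dvd_of_dvd_compose [OF _ w0])
  then have "of_int N dvd ((1 - of_int b * fps_X) * F - 1) * geo b" by (rule dvd_mult2)
  also have "((1 - of_int b * fps_X) * F - 1) * geo b = F * ((1 - of_int b * fps_X) * geo b) - geo b"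
    by (simp add: algebra_simps)
  also have "\<dots> = F - geo b" by (simp only: geo_inverse mult_1_right)
  finally show ?thesis unfolding dvd_diff_geo_iff F_def b_def fps_nth_Abs_fps by blast
qed

text \<open>The quadratic factor from the previous lemma differs from \<open>(1 - l X)^2\<close> by \<open>(c - l^2) X^2\<close>; this is where the
size of \<open>c - l^2\<close> matters for the modulus.\<close>

lemma discriminant_geo:
  "(geo l * h)^2 * (1 - 2 * of_int l * fps_X + of_int c * fps_X^2)
     = h^2 * (1 + of_int (c - l^2) * geo_var l^2)"
proof -
  have "geo l^2 * (1 - 2 * of_int l * fps_X + of_int c * fps_X^2)
     = (geo l - of_int l * geo_var l)^2 + of_int (c - l^2) * geo_var l^2"
    by (simp add: geo_var_def power2_eq_square algebra_simps)
  also have "geo l - of_int l * geo_var l = 1" by (simp add: geo_eq)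
  finally have *: "geo l^2 * (1 - 2 * of_int l * fps_X + of_int c * fps_X^2)
     = 1 + of_int (c - l^2) * geo_var l^2" by simp
  show ?thesis unfolding power_mult_distrib * [symmetric] by (simp add: mult_ac)
qed

text \<open>Modulo 2, squaring a series doubles the exponents: the products \<open>f_k f_(n - k)\<close> and \<open>f_(n - k) f_k\<close> cancel.\<close>

lemma square_cong_mod_2:
  fixes f :: "int fps"
  shows "even ((f^2) $ n) \<longleftrightarrow> odd n \<or> even (f $ (n div 2))"
proof -
  have sym: "(\<Sum>k\<in>{k. k \<le> n \<and> n < 2 * k}. f $ k * f $ (n - k)) = (\<Sum>k\<in>{k. 2 * k < n}. f $ k * f $ (n - k))"
    by (rule sum.reindex_bij_witness [of _ "\<lambda>k. n - k" "\<lambda>k. n - k"]) auto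
  have "(f^2) $ n = (\<Sum>k\<in>{k. 2 * k < n} \<union> {k. k \<le> n \<and> n < 2 * k} \<union> {k. 2 * k = n}. f $ k * f $ (n - k))"
    unfolding fps_square_nth by (intro sum.cong) auto
  also have "\<dots> = 2 * (\<Sum>k\<in>{k. 2 * k < n}. f $ k * f $ (n - k)) + (\<Sum>k\<in>{k. 2 * k = n}. f $ k * f $ (n - k))"
  proof -
    have fin: "finite {k. 2 * k < n}" "finite {k. k \<le> n \<and> n < 2 * k}" "finite {k. 2 * k = n}"
      by (rule finite_subset [of _ "{..n}"]; force)+
    show ?thesis using fin by (subst sum.union_disjoint; (subst sum.union_disjoint)?) (auto simp: sym)
  qed
  finally have *: "(f^2) $ n = \<dots>" .
  show ?thesis
  proof (cases "even n")
    case True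
    then have "{k. 2 * k = n} = {n div 2}" "n - n div 2 = n div 2" by auto
    then show ?thesis unfolding * using True by simp
  next
    case False
    then have "{k. 2 * k = n} = {}" by auto
    then show ?thesis using False unfolding * by simp
  qed
qed

text \<open>Write \<open>trinom = 1 + 6 Y\<close>, so that the square is \<open>1 + 12 (Y + Y^2) + 24 Y^2\<close>. Modulo 2 the series \<open>Y\<close> is the sum of
\<open>X^(2^j)\<close>, hence \<open>Y + Y^2\<close> telescopes to \<open>X\<close>. The parity of the coefficients follows from the recurrence: the one at an odd
index greater than 1 is even because the factor \<open>3 k + 2\<close> is, and the ratio of those at \<open>2 k\<close> and \<open>k\<close> is a
quotient of odd numbers.\<close>

lemma trinom_square: "24 dvd trinom^2 - (1 + 12 * fps_X)"
proof -
  obtain Y where Y: "trinom - 1 = 6 * Y" using trinom_cong by (elim dvdE)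
  have y0: "Y $ 0 = 0" using arg_cong [OF Y, of "\<lambda>f. f $ 0"] by simp
  have H: "trinom $ k = 6 * Y $ k" if "k > 0" for k
    using arg_cong [OF Y, of "\<lambda>f. f $ k"] that by simp
  have rec: "(int k + 1)^2 * Y $ (k + 1) = 3 * (3 * int k + 1) * (3 * int k + 2) * Y $ k" if "k > 0" for k
    using trinom_rec [of k] H [of k] H [of "k + 1"] that by (simp add: algebra_simps power2_eq_square)
  have y1: "Y $ 1 = 1" using H [of 1] by (simp add: trinom_def)
  have odd_index: "even (Y $ k)" if k: "odd k" "k \<noteq> 1" for k
  proof -
    obtain m where m: "k = 2 * m + 1" "m > 0" using k by (metis gr0I mult_0_right add_0 oddE)
    have "even ((int (2 * m) + 1)^2 * Y $ (2 * m + 1))" using rec [of "2 * m"] m by simp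
    then show ?thesis by (simp add: m)
  qed
  \<comment> \<open>Two steps of the recurrence from \<open>2 k\<close> against one step from \<open>k\<close>: the even factors are the same.\<close>
  have double: "\<exists>p r. odd p \<and> odd r \<and> p * Y $ (2 * k) = r * Y $ k" if "k > 0" for k
    using that
  proof (induction k rule: nat_induct_non_zero)
    case 1
    have "Y $ 2 = 15" using H [of 2] by (simp add: trinom_def eval_nat_numeral)
    then show ?case using y1 by (intro exI [of _ 1] exI [of _ 15]) simp
  next
    case (Suc k)
    then obtain p r where pr: "odd p" "odd r" "p * Y $ (2 * k) = r * Y $ k" by blast
    define x where "x = int k"
    have a: "(2 * x + 1)^2 * Y $ (2 * k + 1) = 3 * (6 * x + 1) * (6 * x + 2) * Y $ (2 * k)"
      using rec [of "2 * k"] Suc by (simp add: x_def)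
    have b: "(2 * x + 2)^2 * Y $ (2 * k + 2) = 3 * (6 * x + 4) * (6 * x + 5) * Y $ (2 * k + 1)"
      using rec [of "2 * k + 1"] Suc by (simp add: x_def algebra_simps)
    have c: "(x + 1)^2 * Y $ (k + 1) = 3 * (3 * x + 1) * (3 * x + 2) * Y $ k"
      using rec [of k] Suc by (simp add: x_def)
    have "4 * (x + 1)^2 * ((p * (2 * x + 1)^2) * Y $ (2 * k + 2))
        = p * (2 * x + 1)^2 * ((2 * x + 2)^2 * Y $ (2 * k + 2))" by algebra
    also have "\<dots> = 3 * (6 * x + 4) * (6 * x + 5) * p * ((2 * x + 1)^2 * Y $ (2 * k + 1))"
      unfolding b by algebra
    also have "\<dots> = 9 * (6 * x + 4) * (6 * x + 5) * (6 * x + 1) * (6 * x + 2) * (p * Y $ (2 * k))"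
      unfolding a by algebra
    also have "\<dots> = 4 * (r * (3 * (6 * x + 1) * (6 * x + 5))) * (3 * (3 * x + 1) * (3 * x + 2) * Y $ k)"
      unfolding pr(3) by algebra
    also have "\<dots> = 4 * (x + 1)^2 * ((r * (3 * (6 * x + 1) * (6 * x + 5))) * Y $ (k + 1))"
      unfolding c [symmetric] by algebra
    finally have "4 * (x + 1)^2 * ((p * (2 * x + 1)^2) * Y $ (2 * k + 2))
        = 4 * (x + 1)^2 * ((r * (3 * (6 * x + 1) * (6 * x + 5))) * Y $ (k + 1))" .
    then have "(p * (2 * x + 1)^2) * Y $ (2 * k + 2) = (r * (3 * (6 * x + 1) * (6 * x + 5))) * Y $ (k + 1)"
      by (simp add: x_def)
    moreover have "odd (p * (2 * x + 1)^2)" "odd (r * (3 * (6 * x + 1) * (6 * x + 5)))"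
      using pr by auto
    moreover have "2 * k + 2 = 2 * Suc k" "k + 1 = Suc k" by simp_all
    ultimately show ?case by metis
  qed
  have even_index: "even (Y $ (2 * k)) \<longleftrightarrow> even (Y $ k)" for k
  proof (cases "k = 0")
    case False
    then obtain p r where "odd p" "odd r" and pr: "p * Y $ (2 * k) = r * Y $ k" using double [of k] by blast
    have "even (p * Y $ (2 * k)) \<longleftrightarrow> even (r * Y $ k)" by (simp only: pr)
    then show ?thesis using \<open>odd p\<close> \<open>odd r\<close> unfolding even_mult_iff by blast
  qed simp
  have "2 dvd (Y + Y^2 - fps_X) $ k" for k
  proof (cases "even k")
    case True
    then obtain m where "k = 2 * m" by (elim evenE)
    then show ?thesis using even_index [of m] square_cong_mod_2 [of Y k] by (auto simp: fps_X_def)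
  next
    case False
    then show ?thesis using odd_index [of k] y1 square_cong_mod_2 [of Y k] by (cases "k = 1") (auto simp: fps_X_def)
  qed
  then have "2 dvd Y + Y^2 - fps_X" using of_int_fps_dvd_iff [of 2] by simp
  then obtain Z where "Y + Y^2 - fps_X = 2 * Z" by (elim dvdE)
  then have X: "fps_X = Y + Y^2 - 2 * Z" by (simp add: algebra_simps)
  have HY: "trinom = 1 + 6 * Y" using Y by (simp add: algebra_simps)
  have "trinom^2 - (1 + 12 * fps_X) = 24 * (Z + Y^2)" unfolding X HY by algebra
  then show ?thesis by simp
qed

section \<open>The congruences\<close>

lemma trinom_compose_square:
  assumes "r $ 0 = 0"
  obtains K where "(trinom oo r)^2 = 1 + 12 * r + 24 * K"
proof -
  have "of_int 24 dvd (trinom^2 oo r) - ((1 + 12 * fps_X) oo r)"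
    by (rule compose_dvd) (use trinom_square assms in simp_all)
  then obtain K where "(trinom^2 oo r) - ((1 + 12 * fps_X) oo r) = 24 * K" by (auto elim!: dvdE)
  then have "(trinom oo r)^2 = 1 + 12 * r + 24 * K"
    using assms by (simp add: fps_compose_power fps_compose_add_distrib fps_compose_mult_distrib algebra_simps)
  then show ?thesis by (rule that)
qed

text \<open>If \<open>N\<close> divides \<open>c - l^2\<close>, the modulus passes unchanged from a sequence of the second kind to its
symmetric square.\<close>

lemma symmetric_square_cong_of_cong:
  assumes u: "second_kind_rec a c l u" and v: "first_kind_rec a (a - 2 * l) (a^2 - 4 * c) 0 v"
    and cong: "\<And>n. [u n = l ^ n] (mod N)" and N: "N dvd c - l^2"
  shows "[v n = (a - 2 * l) ^ n] (mod N)"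
proof (rule symmetric_square_cong [OF u v])
  have "of_int N dvd Abs_fps u - geo l" using cong by (simp add: dvd_diff_geo_iff)
  then obtain J where J: "Abs_fps u - geo l = of_int N * J" by (elim dvdE)
  define h where "h = (1 - of_int l * fps_X) * Abs_fps u"
  have "h = (1 - of_int l * fps_X) * geo l + (1 - of_int l * fps_X) * (Abs_fps u - geo l)"
    by (simp add: h_def algebra_simps)
  then have h: "h = 1 + of_int N * ((1 - of_int l * fps_X) * J)"
    by (simp only: J geo_inverse mult.left_commute)
  have "geo l * h = ((1 - of_int l * fps_X) * geo l) * Abs_fps u"
    by (simp add: h_def algebra_simps)
  then have f: "geo l * h = Abs_fps u" by (simp only: geo_inverse mult_1)
  obtain d where d: "c - l^2 = N * d" using N by (elim dvdE)
  have "Abs_fps u ^ 2 * (1 - 2 * of_int l * fps_X + of_int c * fps_X^2) - 1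
      = h^2 * (1 + of_int N * of_int d * geo_var l^2) - 1"
    using discriminant_geo [of l h c] unfolding f d of_int_mult by simp
  also have "\<dots> = (h - 1) * (h + 1) + of_int N * (of_int d * h^2 * geo_var l^2)"
    by (simp add: algebra_simps power2_eq_square)
  finally have eq: "Abs_fps u ^ 2 * (1 - 2 * of_int l * fps_X + of_int c * fps_X^2) - 1
      = (h - 1) * (h + 1) + of_int N * (of_int d * h^2 * geo_var l^2)" .
  have "of_int N dvd h - 1" unfolding h by simp
  then show "of_int N dvd Abs_fps u ^ 2 * (1 - 2 * of_int l * fps_X + of_int c * fps_X^2) - 1"
    unfolding eq by (intro dvd_add dvd_mult2 dvd_triv_left)
qed

lemma second_kind_congruences:
  "second_kind_rec 7 (- 8) 2 u \<Longrightarrow> [u n = 2 ^ n] (mod 6)"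
  "second_kind_rec 9 27 3 u \<Longrightarrow> [u n = 3 ^ n] (mod 6)"
  "second_kind_rec 10 9 3 u \<Longrightarrow> [u n = 3 ^ n] (mod 6)"
  "second_kind_rec 11 (- 1) 3 u \<Longrightarrow> [u n = 3 ^ n] (mod 10)"
  "second_kind_rec 12 32 4 u \<Longrightarrow> [u n = 4 ^ n] (mod 4)"
  "second_kind_rec 17 72 6 u \<Longrightarrow> [u n = 6 ^ n] (mod 6)"
proof -
  show "second_kind_rec 7 (- 8) 2 u \<Longrightarrow> [u n = 2 ^ n] (mod 6)"
    by (erule second_kind_pullback_cong [OF _ second_kind_A]) (use trinom_cong in \<open>simp_all add: geo_var_def\<close>)
  show "second_kind_rec 9 27 3 u \<Longrightarrow> [u n = 3 ^ n] (mod 6)"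
    by (erule second_kind_pullback_cong [OF _ second_kind_B]) (use trinom_cong in \<open>simp_all add: geo_var_def\<close>)
  show "second_kind_rec 10 9 3 u \<Longrightarrow> [u n = 3 ^ n] (mod 6)"
    by (erule second_kind_pullback_cong [OF _ second_kind_C]) (use trinom_cong in \<open>simp_all add: geo_var_def\<close>)
  show "second_kind_rec 11 (- 1) 3 u \<Longrightarrow> [u n = 3 ^ n] (mod 10)"
    using second_kind_rec_unique [OF _ second_kind_D] sum_D_cong by blast
  show "second_kind_rec 12 32 4 u \<Longrightarrow> [u n = 4 ^ n] (mod 4)"
    by (erule second_kind_pullback_cong [OF _ second_kind_E]) (use sqbinom_cong in \<open>simp_all add: geo_var_def\<close>)
  show "second_kind_rec 17 72 6 u \<Longrightarrow> [u n = 6 ^ n] (mod 6)"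
    by (erule second_kind_pullback_cong [OF _ second_kind_F]) (use trinom_cong in \<open>simp_all add: geo_var_def\<close>)
qed

text \<open>Sequence \<open>\<delta>\<close> is the symmetric square of A. The congruence modulo 6 for A would give only the modulus 6; the factor 4 is gained from the
congruence \<open>trinom^2 = 1 + 12 X\<close> modulo 24: with \<open>c - l^2 = - 12\<close> the two contributions \<open>12 t^2\<close> and \<open>- 12 t^2\<close> cancel. For
\<open>\<alpha>\<close>, the symmetric square of C, there is \<open>c - l^2 = 0\<close> and \<open>12 t^2\<close> survives, whereas for \<open>\<gamma>\<close>, that of F,
\<open>12 t^2 + 36 t^2\<close> is again divisible by 24.\<close>

lemma first_kind_delta_cong:
  assumes "first_kind_rec 7 3 81 0 u" shows "[u n = 3 ^ n] (mod 24)"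
proof -
  define t where "t = geo_var 2"
  have t0: "(t^2 * (1 + 2 * t)) $ 0 = 0" by (simp add: t_def geo_var_def)
  obtain K where K: "(trinom oo t^2 * (1 + 2 * t))^2 = 1 + 12 * (t^2 * (1 + 2 * t)) + 24 * K"
    by (rule trinom_compose_square [OF t0])
  have "[u n = (7 - 2 * 2) ^ n] (mod 24)"
  proof (rule symmetric_square_cong [OF second_kind_A])
    have "(geo 2 * (trinom oo t^2 * (1 + 2 * t)))^2 * (1 - 2 * of_int 2 * fps_X + of_int (- 8) * fps_X^2) - 1
        = of_int 24 * (t^3 + K - 6 * t^4 - 12 * t^5 - 12 * K * t^2)"
      unfolding discriminant_geo t_def [symmetric] K by (simp; algebra)
    then show "of_int 24 dvd Abs_fps (fps_nth (geo 2 * (trinom oo geo_var 2 ^ 2 * (1 + 2 * geo_var 2))))^2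
       * (1 - 2 * of_int 2 * fps_X + of_int (- 8) * fps_X^2) - 1"
      unfolding fps_nth_inverse t_def by (metis dvd_triv_left)
  qed (use assms in simp)
  then show ?thesis by simp
qed

lemma first_kind_alpha_cong:
  assumes "first_kind_rec 10 4 64 0 u" shows "[u n = 4 ^ n] (mod 12)"
proof -
  define t where "t = geo_var 3"
  have t0: "(t^2 * (1 + 2 * t)) $ 0 = 0" by (simp add: t_def geo_var_def)
  obtain K where K: "(trinom oo t^2 * (1 + 2 * t))^2 = 1 + 12 * (t^2 * (1 + 2 * t)) + 24 * K"
    by (rule trinom_compose_square [OF t0])
  have "[u n = (10 - 2 * 3) ^ n] (mod 12)"
  proof (rule symmetric_square_cong [OF second_kind_C])
    have "(geo 3 * (trinom oo t^2 * (1 + 2 * t)))^2 * (1 - 2 * of_int 3 * fps_X + of_int 9 * fps_X^2) - 1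
        = of_int 12 * (t^2 * (1 + 2 * t) + 2 * K)"
      unfolding discriminant_geo t_def [symmetric] K by (simp; algebra)
    then show "of_int 12 dvd Abs_fps (fps_nth (geo 3 * (trinom oo geo_var 3 ^ 2 * (1 + 2 * geo_var 3))))^2
       * (1 - 2 * of_int 3 * fps_X + of_int 9 * fps_X^2) - 1"
      unfolding fps_nth_inverse t_def by (metis dvd_triv_left)
  qed (use assms in simp)
  then show ?thesis by simp
qed

lemma first_kind_gamma_cong:
  assumes "first_kind_rec 17 5 1 0 u" shows "[u n = 5 ^ n] (mod 24)"
proof -
  define t where "t = geo_var 6"
  have t0: "(t^2 * (1 - 2 * t)) $ 0 = 0" by (simp add: t_def geo_var_def)
  obtain K where K: "(trinom oo t^2 * (1 - 2 * t))^2 = 1 + 12 * (t^2 * (1 - 2 * t)) + 24 * K"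
    by (rule trinom_compose_square [OF t0])
  have "[u n = (17 - 2 * 6) ^ n] (mod 24)"
  proof (rule symmetric_square_cong [OF second_kind_F])
    have "(geo 6 * (trinom oo t^2 * (1 - 2 * t)))^2 * (1 - 2 * of_int 6 * fps_X + of_int 72 * fps_X^2) - 1
        = of_int 24 * (2 * t^2 - t^3 + K + 18 * t^4 - 36 * t^5 + 36 * K * t^2)"
      unfolding discriminant_geo t_def [symmetric] K by (simp; algebra)
    then show "of_int 24 dvd Abs_fps (fps_nth (geo 6 * (trinom oo geo_var 6 ^ 2 * (1 - 2 * geo_var 6))))^2
       * (1 - 2 * of_int 6 * fps_X + of_int 72 * fps_X^2) - 1"
      unfolding fps_nth_inverse t_def by (metis dvd_triv_left)
  qed (use assms in simp)
  then show ?thesis by simp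
qed

text \<open>Sequences \<open>\<eta>\<close> and \<open>\<zeta>\<close> are the symmetric squares of D and B.\<close>

lemma first_kind_eta_cong:
  assumes "first_kind_rec 11 5 125 0 u" shows "[u n = 5 ^ n] (mod 10)"
proof -
  have "[u n = (11 - 2 * 3) ^ n] (mod 10)"
    by (rule symmetric_square_cong_of_cong [OF second_kind_D]) (use assms sum_D_cong in simp_all)
  then show ?thesis by simp
qed

lemma first_kind_zeta_cong:
  assumes "first_kind_rec 9 3 (- 27) 0 u" shows "[u n = 3 ^ n] (mod 6)"
proof -
  have "[u n = (9 - 2 * 3) ^ n] (mod 6)"
    by (rule symmetric_square_cong_of_cong [OF second_kind_B])
       (use assms second_kind_congruences(2) [OF second_kind_B] in simp_all)
  then show ?thesis by simp
qed

lemma first_kind_epsilon_cong: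
  assumes "first_kind_rec 12 4 16 0 u" shows "[u n = 4 ^ n] (mod 24)"
proof -
  let ?r = "geo_var 4 ^ 2 * geo 4 ^ 2"
  have "of_int 24 dvd (quadrinom oo ?r) - (1 oo ?r)"
    by (rule compose_dvd) (use quadrinom_cong in \<open>simp_all add: geo_var_def\<close>)
  then have "of_int 24 dvd geo 4 * ((quadrinom oo ?r) - 1)" by simp
  then have "of_int 24 dvd geo 4 * (quadrinom oo ?r) - geo 4" by (simp add: right_diff_distrib)
  then show ?thesis
    unfolding dvd_diff_geo_iff first_kind_rec_unique [OF assms first_kind_epsilon] by blast
qed

lemma first_kind_s18_cong:
  assumes "first_kind_rec 14 6 192 (- 12) u" shows "[u n = 6 ^ n] (mod 6)"
proof -
  let ?r = "fps_X * geo_var 12 ^ 2"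
  have "of_int 6 dvd (quadrinom oo ?r) - (1 oo ?r)"
  proof (rule compose_dvd)
    show "of_int 6 dvd quadrinom - 1" using quadrinom_cong by (intro dvd_trans [OF _ quadrinom_cong]) (simp add: dvd_def, rule exI [of _ 4], simp)
  qed simp
  then have "of_int 6 dvd inv_sqrt * ((quadrinom oo ?r) - 1)" by simp
  moreover have "of_int 6 dvd inv_sqrt - 1" using inv_sqrt_cong by simp
  moreover have "of_int 6 dvd 1 - geo 6"
    unfolding of_int_fps_dvd_iff by (auto simp: fps_one_def power_0_left)
  ultimately have "of_int 6 dvd inv_sqrt * ((quadrinom oo ?r) - 1) + ((inv_sqrt - 1) + (1 - geo 6))"
    by (intro dvd_add)
  then have "of_int 6 dvd inv_sqrt * (quadrinom oo ?r) - geo 6" by (simp add: right_diff_distrib)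
  then show ?thesis
    unfolding dvd_diff_geo_iff first_kind_rec_unique [OF assms first_kind_s18] by blast
qed

text \<open>These are the sequences \<open>s_7\<close> and \<open>s_10\<close>.\<close>

lemma first_kind_congruences:
  "first_kind_rec 13 4 (- 27) 3 u \<Longrightarrow> [u n = 4 ^ n] (mod 8)"
  "first_kind_rec 6 2 (- 64) 4 u \<Longrightarrow> [u n = 2 ^ n] (mod 2)"
  using first_kind_rec_unique [OF _ first_kind_s7] sum_s7_cong
    first_kind_rec_unique [OF _ first_kind_s10] sum_s10_cong by blast+

section \<open>The largest modulus\<close>

text \<open>Modulo \<open>N\<close> the transform is the binomial expansion of \<open>(x - x)^n\<close>.\<close>

lemma binomial_transform_dvd:
  assumes "\<And>k. [u k = x ^ k] (mod N)" "n > 0"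
  shows "N dvd binomial_transform u x n"
proof -
  have "[binomial_transform u x n = (\<Sum>k=0..n. of_nat (n choose k) * (- x) ^ (n - k) * x ^ k)] (mod N)"
    unfolding binomial_transform_def by (intro cong_sum cong_mult cong_refl) (simp add: assms)
  also have "(\<Sum>k=0..n. of_nat (n choose k) * (- x) ^ (n - k) * x ^ k) = (x + (- x)) ^ n"
    unfolding binomial_ring by (simp add: atLeast0AtMost mult_ac)
  finally show ?thesis using assms(2) by (simp add: cong_0_iff power_0_left)
qed

text \<open>If \<open>N\<close> is a modulus for any \<open>\<beta>\<close>, then \<open>\<beta>\<close> is congruent to \<open>u 1\<close>, so \<open>N\<close> is also a modulus for \<open>u 1\<close> and divides all the
binomial transforms. Consequently all moduli divide \<open>G\<close>, and \<open>G\<close> is the largest one as soon as it is a modulus.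
Boundedness by \<open>G\<close> also ensures that the maximum defining \<open>N_max\<close> is attained for every \<open>\<alpha>\<close>.\<close>

lemma N_max_eqI:
  assumes G: "G = Gcd (binomial_transform u (u 1) ` S)" "G > 0" and S: "0 \<notin> S"
    and cong: "\<And>n. [u n = u 1 ^ n] (mod G)"
  shows "N_max u (u 1) = G" and "N_max u \<alpha> dvd G"
proof -
  have dvd: "N dvd G" if N: "\<And>n. [u n = \<beta> ^ n] (mod N)" for N \<beta>
  proof -
    have "[\<beta> = u 1] (mod N)" using N [of 1] by (simp add: cong_sym)
    then have "[u n = u 1 ^ n] (mod N)" for n using N [of n] by (meson cong_pow cong_trans)
    then have "N dvd binomial_transform u (u 1) n" if "n \<in> S" for n
      using S that by (intro binomial_transform_dvd) (auto intro: gr0I)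
    then show ?thesis unfolding G by (intro Gcd_greatest) auto
  qed
  have le: "N \<le> G" if "\<forall>n. [u n = \<beta> ^ n] (mod N)" for N \<beta>
    using dvd [of \<beta> N] that G(2) by (auto intro: zdvd_imp_le)
  show "N_max u (u 1) = G"
    unfolding N_max_def using G(2) cong le by (intro Greatest_equality) auto
  let ?A = "{N. N > 0 \<and> (\<forall>n. [u n = \<alpha> ^ n] (mod N))}"
  have "?A \<subseteq> {1..G}" using le by auto
  then have fin: "finite ?A" by (rule finite_subset) simp
  have "1 \<in> ?A" by simp
  then have "Max ?A \<in> ?A" using fin by (intro Max_in) blast+
  moreover have "N_max u \<alpha> = Max ?A"
    unfolding N_max_def
    by (rule Greatest_equality) (use \<open>Max ?A \<in> ?A\<close> fin in \<open>auto intro!: Max_ge\<close>)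
  ultimately show "N_max u \<alpha> dvd G" using dvd by auto
qed

lemma second_kind_values:
  assumes "second_kind_rec A B l u"
  shows "u 0 = 1" "u 1 = l" "4 * u 2 = (2 * A + l) * l - B" "9 * u 3 = (6 * A + l) * u 2 - 4 * B * l"
proof -
  have u0: "u 0 = 1" and rec: "(int n + 1)^2 * u (n + 1) - (A * int n ^ 2 + A * int n + l) * u n
      + B * int n ^ 2 * (if n = 0 then 0 else u (n - 1)) = 0" for n
    using assms unfolding second_kind_rec_def by auto
  show "u 0 = 1" by (rule u0)
  show u1: "u 1 = l" using rec [of 0] by (simp add: u0)
  show "4 * u 2 = (2 * A + l) * l - B" using rec [of 1] u0 u1 by (simp add: numeral_2_eq_2 algebra_simps)
  show "9 * u 3 = (6 * A + l) * u 2 - 4 * B * l" using rec [of 2] u1 by (simp add: numeral_3_eq_3 algebra_simps)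
qed

lemma first_kind_values:
  assumes "first_kind_rec a b c d u"
  shows "u 0 = 1" "u 1 = b" "8 * u 2 = 3 * (2 * a + b) * b - (c + d)"
    "27 * u 3 = 5 * (6 * a + b) * u 2 - 2 * (4 * c + d) * b"
    "64 * u 4 = 7 * (12 * a + b) * u 3 - 3 * (9 * c + d) * u 2"
proof -
  have u0: "u 0 = 1" and rec: "(int n + 1)^3 * u (n + 1) - (2 * int n + 1) * (a * int n ^ 2 + a * int n + b) * u n
      + int n * (c * int n ^ 2 + d) * (if n = 0 then 0 else u (n - 1)) = 0" for n
    using assms unfolding first_kind_rec_def by auto
  show "u 0 = 1" by (rule u0)
  show u1: "u 1 = b" using rec [of 0] by (simp add: u0)
  show "8 * u 2 = 3 * (2 * a + b) * b - (c + d)" using rec [of 1] u0 u1 by (simp add: numeral_2_eq_2 algebra_simps)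
  show "27 * u 3 = 5 * (6 * a + b) * u 2 - 2 * (4 * c + d) * b" using rec [of 2] u1 by (simp add: numeral_3_eq_3 algebra_simps)
  show "64 * u 4 = 7 * (12 * a + b) * u 3 - 3 * (9 * c + d) * u 2" using rec [of 3] by (simp add: algebra_simps)
qed

lemma binomial_transform_values:
  fixes x :: int
  assumes "u 0 = 1"
  shows "binomial_transform u x 1 = u 1 - x"
    "binomial_transform u x 2 = u 2 - 2 * x * u 1 + x^2"
    "binomial_transform u x 3 = u 3 - 3 * x * u 2 + 3 * x^2 * u 1 - x^3"
    "binomial_transform u x 4 = u 4 - 4 * x * u 3 + 6 * x^2 * u 2 - 4 * x^3 * u 1 + x^4"
  using assms by (simp_all add: binomial_transform_def eval_nat_numeral algebra_simps)

text \<open>Here \<open>y\<close> and \<open>z\<close> are the values \<open>u 2\<close> and \<open>u 3\<close>; passing them as arguments leaves only arithmetic of numerals in the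
individual cases.\<close>

lemma second_kind_conclusion:
  assumes rec: "second_kind_rec A B l u"
    and cong: "\<And>n. [u n = l ^ n] (mod G)"
    and y: "4 * y = (2 * A + l) * l - B" and z: "9 * z = (6 * A + l) * y - 4 * B * l"
    and G: "gcd (y - l^2) (z - 3 * l * y + 2 * l^3) = G" "G > 0"
  shows "(\<forall>\<alpha>. N_max u \<alpha> dvd N_max u (u 1)) \<and> N_max u (u 1) = M_gcd Second_Kind u (u 1) \<and>
    M_gcd Second_Kind u (u 1) = Gcd {binomial_transform u (u 1) 2, binomial_transform u (u 1) 3}"
proof -
  note vals = second_kind_values [OF rec]
  have u2: "u 2 = y" using vals(3) y by simp
  have u3: "u 3 = z" using vals(4) z u2 by simp
  have v: "binomial_transform u (u 1) 1 = 0" "binomial_transform u (u 1) 2 = y - l^2"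
    "binomial_transform u (u 1) 3 = z - 3 * l * y + 2 * l^3"
    unfolding binomial_transform_values [of u, OF vals(1)] vals(2) u2 u3
    by (simp_all add: power2_eq_square power3_eq_cube)
  have M: "G = Gcd (binomial_transform u (u 1) ` {1, 2, 3})"
    unfolding image_insert v using G by simp
  have c: "[u n = u 1 ^ n] (mod G)" for n unfolding vals(2) by (rule cong)
  have N: "N_max u (u 1) = G" "N_max u \<alpha> dvd G" for \<alpha>
    using N_max_eqI [OF M G(2) _ c] by auto
  have M': "M_gcd Second_Kind u (u 1) = G" using M by simp
  have "Gcd {binomial_transform u (u 1) 2, binomial_transform u (u 1) 3} = G"
    unfolding v using G by simp
  then show ?thesis unfolding N(1) M' using N(2) by simp
qed

lemma first_kind_conclusion:
  assumes rec: "first_kind_rec a b c d u"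
    and cong: "\<And>n. [u n = b ^ n] (mod G)"
    and x: "8 * x = 3 * (2 * a + b) * b - (c + d)"
    and y: "27 * y = 5 * (6 * a + b) * x - 2 * (4 * c + d) * b"
    and z: "64 * z = 7 * (12 * a + b) * y - 3 * (9 * c + d) * x"
    and G: "gcd (x - b^2) (gcd (y - 3 * b * x + 2 * b^3) (z - 4 * b * y + 6 * b^2 * x - 3 * b^4)) = G" "G > 0"
  shows "(\<forall>\<alpha>. N_max u \<alpha> dvd N_max u (u 1)) \<and> N_max u (u 1) = M_gcd First_Kind u (u 1) \<and>
    M_gcd First_Kind u (u 1) = Gcd {binomial_transform u (u 1) 2, binomial_transform u (u 1) 3,
      binomial_transform u (u 1) 4}"
proof -
  note vals = first_kind_values [OF rec]
  have u2: "u 2 = x" using vals(3) x by simp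
  have u3: "u 3 = y" using vals(4) y u2 by simp
  have u4: "u 4 = z" using vals(5) z u2 u3 by simp
  have v: "binomial_transform u (u 1) 1 = 0" "binomial_transform u (u 1) 2 = x - b^2"
    "binomial_transform u (u 1) 3 = y - 3 * b * x + 2 * b^3"
    "binomial_transform u (u 1) 4 = z - 4 * b * y + 6 * b^2 * x - 3 * b^4"
    unfolding binomial_transform_values [of u, OF vals(1)] vals(2) u2 u3 u4
    by (simp_all add: power2_eq_square power3_eq_cube power4_eq_xxxx)
  have M: "G = Gcd (binomial_transform u (u 1) ` {1, 2, 3, 4})"
    unfolding image_insert v using G by simp
  have c: "[u n = u 1 ^ n] (mod G)" for n unfolding vals(2) by (rule cong)
  have N: "N_max u (u 1) = G" "N_max u \<alpha> dvd G" for \<alpha>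
    using N_max_eqI [OF M G(2) _ c] by auto
  have M': "M_gcd First_Kind u (u 1) = G" using M by simp
  have "Gcd {binomial_transform u (u 1) 2, binomial_transform u (u 1) 3,
      binomial_transform u (u 1) 4} = G"
    unfolding v using G by simp
  then show ?thesis unfolding N(1) M' using N(2) by simp
qed

theorem theorem1p2:
  fixes u :: "nat \<Rightarrow> int" and K :: apery_kind
  assumes "apery_like K u"
  shows "(\<forall>\<alpha>::int. N_max u \<alpha> dvd N_max u (u 1)) \<and>
    N_max u (u 1) = M_gcd K u (u 1) \<and>
    M_gcd K u (u 1) =
      (case K of
        Second_Kind \<Rightarrow> Gcd {binomial_transform u (u 1) 2, binomial_transform u (u 1) 3}
      | First_Kind \<Rightarrow> Gcd {binomial_transform u (u 1) 2, binomial_transform u (u 1) 3,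
                           binomial_transform u (u 1) 4})"
proof (cases K)
  case Second_Kind
  then consider "second_kind_rec 7 (- 8) 2 u" | "second_kind_rec 9 27 3 u"
    | "second_kind_rec 10 9 3 u" | "second_kind_rec 11 (- 1) 3 u"
    | "second_kind_rec 12 32 4 u" | "second_kind_rec 17 72 6 u"
    using assms by (auto simp: second_kind_params_def)
  then have "(\<forall>\<alpha>. N_max u \<alpha> dvd N_max u (u 1)) \<and> N_max u (u 1) = M_gcd Second_Kind u (u 1) \<and>
    M_gcd Second_Kind u (u 1) = Gcd {binomial_transform u (u 1) 2, binomial_transform u (u 1) 3}"
  proof cases
    case 1 show ?thesis
      by (rule second_kind_conclusion [OF 1 second_kind_congruences(1) [OF 1], of 10 56]) code_simp+
  next
    case 2 show ?thesis
      by (rule second_kind_conclusion [OF 2 second_kind_congruences(2) [OF 2], of 9 21]) code_simp+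
  next
    case 3 show ?thesis
      by (rule second_kind_conclusion [OF 3 second_kind_congruences(3) [OF 3], of 15 93]) code_simp+
  next
    case 4 show ?thesis
      by (rule second_kind_conclusion [OF 4 second_kind_congruences(4) [OF 4], of 19 147]) code_simp+
  next
    case 5 show ?thesis
      by (rule second_kind_conclusion [OF 5 second_kind_congruences(5) [OF 5], of 20 112]) code_simp+
  next
    case 6 show ?thesis
      by (rule second_kind_conclusion [OF 6 second_kind_congruences(6) [OF 6], of 42 312]) code_simp+
  qed
  then show ?thesis unfolding Second_Kind apery_kind.case .
next
  case First_Kind
  then consider "first_kind_rec 7 3 81 0 u" | "first_kind_rec 11 5 125 0 u"
    | "first_kind_rec 10 4 64 0 u" | "first_kind_rec 12 4 16 0 u" | "first_kind_rec 9 3 (- 27) 0 u"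
    | "first_kind_rec 17 5 1 0 u" | "first_kind_rec 13 4 (- 27) 3 u"
    | "first_kind_rec 6 2 (- 64) 4 u" | "first_kind_rec 14 6 192 (- 12) u"
    using assms by (auto simp: first_kind_params_def)
  then have "(\<forall>\<alpha>. N_max u \<alpha> dvd N_max u (u 1)) \<and> N_max u (u 1) = M_gcd First_Kind u (u 1) \<and>
    M_gcd First_Kind u (u 1) = Gcd {binomial_transform u (u 1) 2, binomial_transform u (u 1) 3,
      binomial_transform u (u 1) 4}"
  proof cases
    case 1 show ?thesis
      by (rule first_kind_conclusion [OF 1 first_kind_delta_cong [OF 1], of 9 3 "- 279"]) code_simp+
  next
    case 2 show ?thesis
      by (rule first_kind_conclusion [OF 2 first_kind_eta_cong [OF 2], of 35 275 2275]) code_simp+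
  next
    case 3 show ?thesis
      by (rule first_kind_conclusion [OF 3 first_kind_alpha_cong [OF 3], of 28 256 2716]) code_simp+
  next
    case 4 show ?thesis
      by (rule first_kind_conclusion [OF 4 first_kind_epsilon_cong [OF 4], of 40 544 8536]) code_simp+
  next
    case 5 show ?thesis
      by (rule first_kind_conclusion [OF 5 first_kind_zeta_cong [OF 5], of 27 309 4059]) code_simp+
  next
    case 6 show ?thesis
      by (rule first_kind_conclusion [OF 6 first_kind_gamma_cong [OF 6], of 73 1445 33001]) code_simp+
  next
    case 7 show ?thesis
      by (rule first_kind_conclusion [OF 7 first_kind_congruences(1) [OF 7], of 48 760 13840]) code_simp+
  next
    case 8 show ?thesis
      by (rule first_kind_conclusion [OF 8 first_kind_congruences(2) [OF 8], of 18 164 1810]) code_simp+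
  next
    case 9 show ?thesis
      by (rule first_kind_conclusion [OF 9 first_kind_s18_cong [OF 9], of 54 564 6390]) code_simp+
  qed
  then show ?thesis unfolding First_Kind apery_kind.case .
qed

end
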